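(* If $\rho(P_{\mathrm{DC}})<1$, then $\rho(P_{\mathrm{RC}})<1$, where $P_{\mathrm{DC}}$ and $P_{\mathrm{RC}}$ are the deterministic-scan and random-scan conditional Metropolis-Hastings kernels with the same proposal density, and the selection probability $r\in(0,1)$ of $P_{\mathrm{RC}}$ is arbitrary.
   Context: Setting. $(\mathsf{X}\times\mathsf{Y},\mathcal{F}_X\times\mathcal{F}_Y)$ is a product measurable space with a joint probability distribution $\Pi(dx,dy)$; $\Pi_X,\Pi_Y$ are its marginals and $\Pi_{X|Y}(dx|y)$, $\Pi_{Y|X}(dy|x)$ its full conditional distributions (regular conditional probabilities), which admit densities $\pi_{X|Y}(\cdot|y)$ and $\pi_{Y|X}(\cdot|x)$ with respect to $\sigma$-finite reference measures on $\mathsf{X}$ and $\mathsf{Y}$, written $dx$ and $dy$. Standing assumption: there exist disjoint $A_1,A_2\in\mathcal{F}_X$ with $\Pi_X(A_1),\Pi_X(A_2)>0$ and disjoint $B_1,B_2\in\mathcal{F}_Y$ with $\Pi_Y(B_1),\Pi_Y(B_2)>0$. For $(x,y)\in\mathsf{X}\times\mathsf{Y}$, $q(\cdot|x,y)$ is a proposal probability density on $\mathsf{X}$ (jointly measurable). The Metropolis-Hastings kernel is \[P_{\mathrm{MH}}(dx'|x,y)=q(x'|x,y)a(x';x,y)\,dx'+\Big(1-\int q(z|x,y)a(z;x,y)\,dz\Big)\delta_x(dx'),\] \[a(z;x,y)=\min\Big\{1,\frac{\pi_{X|Y}(z|y)q(x|z,y)}{\pi_{X|Y}(x|y)q(z|x,y)}\Big\}\quad(\text{equal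 to }1\text{ if the denominator is }0).\] For each $y$ it is reversible with respect to $\Pi_{X|Y}(\cdot|y)$. Kernels on $\mathsf{X}\times\mathsf{Y}$, both with invariant distribution $\Pi$ ($\delta$ denotes point masses): \[P_{\mathrm{DC}}((x,y),(dx',dy'))=P_{\mathrm{MH}}(dx'|x,y')\Pi_{Y|X}(dy'|x),\] \[P_{\mathrm{RC}}((x,y),(dx',dy'))=r\,P_{\mathrm{MH}}(dx'|x,y)\delta_y(dy')+(1-r)\Pi_{Y|X}(dy'|x)\delta_x(dx').\] $L^2$ convergence rate. Let $P$ be a Markov transition kernel with invariant probability measure $\omega$. $L^2(\omega)$ is the real Hilbert space of square-integrable real functions, and $L_0^2(\omega)=\{f\in L^2(\omega):\int f\,d\omega=0\}$. For probability measures $\mu,\nu$, $\|\mu-\nu\|_\omega=\sup\{|\int f\,d\mu-\int f\,d\nu|: f\in L_0^2(\omega),\|f\|_\omega=1\}$. $L_*^2(\omega)$ is the set of probability measures $\mu$ with $d\mu/d\omega\in L^2(\omega)$. $(\mu P^n)(A)=\int \mu(dz)P^n(z,A)$, where $P^n$ is the $n$-step kernel. The $L^2$ convergence rate $\rho(P)$ is the infimum of $\rho\in[0,1]$ such that for each $\mu\in L_*^2(\omega)$ there is $C_\mu<\infty$ with $\|\mu P^n-\omega\|_\omega<C_\mu\rho^n$ for every positive integer $n$. *)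

theory Defs
  imports "HOL-Probability.Probability"
begin

section \<open>Real \<open>L\<^sup>2\<close> spaces and the \<open>L\<^sup>2\<close> convergence rate\<close>

text \<open>Elements of \<open>L\<^sup>2(\<omega>)\<close> are represented by functions, not by classes modulo null sets.\<close>

definition L2 :: "'s measure \<Rightarrow> ('s \<Rightarrow> real) set" where
  "L2 \<omega> = {f. f \<in> borel_measurable \<omega> \<and> integrable \<omega> (\<lambda>z. (f z)\<^sup>2)}"

definition L2_norm :: "'s measure \<Rightarrow> ('s \<Rightarrow> real) \<Rightarrow> real" where
  "L2_norm \<omega> f = sqrt (\<integral>z. (f z)\<^sup>2 \<partial>\<omega>)"

definition L2_0 :: "'s measure \<Rightarrow> ('s \<Rightarrow> real) set" where
  "L2_0 \<omega> = {f \<in> L2 \<omega>. (\<integral>z. f z \<partial>\<omega>) = 0}"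

definition L2_star :: "'s measure \<Rightarrow> 's measure set" where
  "L2_star \<omega> = {\<mu>. prob_space \<mu> \<and> sets \<mu> = sets \<omega> \<and> absolutely_continuous \<omega> \<mu> \<and>
     (\<lambda>z. enn2real (RN_deriv \<omega> \<mu> z)) \<in> L2 \<omega>}"

text \<open>The supremum is taken in the extended nonnegative reals, so that it always exists.\<close>

definition L2_dist :: "'s measure \<Rightarrow> 's measure \<Rightarrow> 's measure \<Rightarrow> ennreal" where
  "L2_dist \<omega> \<mu> \<nu> =
     (SUP f\<in>{f \<in> L2_0 \<omega>. L2_norm \<omega> f = 1}. ennreal \<bar>(\<integral>z. f z \<partial>\<mu>) - (\<integral>z. f z \<partial>\<nu>)\<bar>)"

primrec kernel_pow :: "'s measure \<Rightarrow> ('s \<Rightarrow> 's measure) \<Rightarrow> nat \<Rightarrow> 's \<Rightarrow> 's measure" where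
  "kernel_pow M P 0 = return M"
| "kernel_pow M P (Suc n) = (\<lambda>z. kernel_pow M P n z \<bind> P)"

text \<open>
  Intended for a Markov kernel \<open>P\<close> with invariant probability measure \<open>\<omega>\<close>. Then \<open>\<rho> = 1\<close> lies in
  the set below, so this is the infimum of a nonempty set of reals bounded from below.
\<close>

definition L2_rate :: "'s measure \<Rightarrow> ('s \<Rightarrow> 's measure) \<Rightarrow> real" where
  "L2_rate \<omega> P = Inf {\<rho>. 0 \<le> \<rho> \<and> \<rho> \<le> 1 \<and>
     (\<forall>\<mu>\<in>L2_star \<omega>. \<exists>C::real. \<forall>n\<ge>1. L2_dist \<omega> (\<mu> \<bind> kernel_pow \<omega> P n) \<omega> < ennreal (C * \<rho> ^ n))}"


section \<open>Conditional Metropolis--Hastings kernels\<close>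

definition add_measure :: "'s measure \<Rightarrow> 's measure \<Rightarrow> 's measure" where
  "add_measure M N = measure_of (space M) (sets M) (\<lambda>A. emeasure M A + emeasure N A)"

lemma space_add_measure [simp]: "space (add_measure M N) = space M"
  by (simp add: add_measure_def)

lemma sets_add_measure [simp, measurable_cong]: "sets (add_measure M N) = sets M"
  by (simp add: add_measure_def)

lemma emeasure_add_measure:
  assumes "sets M = sets N" and "A \<in> sets M"
  shows "emeasure (add_measure M N) A = emeasure M A + emeasure N A"
proof (rule emeasure_measure_of[OF add_measure_def])
  show "countably_additive (sets (add_measure M N)) (\<lambda>A. emeasure M A + emeasure N A)"
  proof (rule countably_additiveI)
    fix F :: "nat \<Rightarrow> 'a set"
    assume F: "range F \<subseteq> sets (add_measure M N)" "disjoint_family F"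
    show "(\<Sum>i. emeasure M (F i) + emeasure N (F i)) = emeasure M (\<Union>i. F i) + emeasure N (\<Union>i. F i)"
      using F assms(1) by (simp add: suminf_add[symmetric] suminf_emeasure)
  qed
qed (use assms in \<open>auto simp: positive_def dest: sets.sets_into_space\<close>)

text \<open>
  Argument order: \<open>p_XY x y\<close> is the density of \<open>x\<close> given \<open>y\<close>, \<open>p_YX y x\<close> the density of \<open>y\<close> given
  \<open>x\<close>, and \<open>q z x y\<close> the proposal density of \<open>z\<close> given \<open>(x, y)\<close>. Likewise \<open>K_XY y\<close> and \<open>K_YX x\<close>
  are the full conditional distributions of the first and of the second component.
\<close>

locale cond_MH_setting =
  X: sigma_finite_measure MX + Y: sigma_finite_measure MY + prob_space J
  for MX :: "'a measure" and MY :: "'b measure" and J :: "('a \<times> 'b) measure" +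
  fixes K_XY :: "'b \<Rightarrow> 'a measure" and K_YX :: "'a \<Rightarrow> 'b measure"
    and p_XY :: "'a \<Rightarrow> 'b \<Rightarrow> real" and p_YX :: "'b \<Rightarrow> 'a \<Rightarrow> real"
    and q :: "'a \<Rightarrow> 'a \<Rightarrow> 'b \<Rightarrow> real"
  assumes sets_J: "sets J = sets (MX \<Otimes>\<^sub>M MY)"
    and kernel_XY: "K_XY \<in> MY \<rightarrow>\<^sub>M prob_algebra MX"
    and kernel_YX: "K_YX \<in> MX \<rightarrow>\<^sub>M prob_algebra MY"
    and conditional_XY: "\<And>A B. A \<in> sets MX \<Longrightarrow> B \<in> sets MY \<Longrightarrow>
      emeasure J (A \<times> B) = (\<integral>\<^sup>+y\<in>B. emeasure (K_XY y) A \<partial>distr J MY snd)"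
    and conditional_YX: "\<And>A B. A \<in> sets MX \<Longrightarrow> B \<in> sets MY \<Longrightarrow>
      emeasure J (A \<times> B) = (\<integral>\<^sup>+x\<in>A. emeasure (K_YX x) B \<partial>distr J MX fst)"
    and p_XY_measurable: "(\<lambda>(x, y). p_XY x y) \<in> borel_measurable (MX \<Otimes>\<^sub>M MY)"
    and p_YX_measurable: "(\<lambda>(x, y). p_YX y x) \<in> borel_measurable (MX \<Otimes>\<^sub>M MY)"
    and p_XY_nonneg: "\<And>x y. x \<in> space MX \<Longrightarrow> y \<in> space MY \<Longrightarrow> 0 \<le> p_XY x y"
    and p_YX_nonneg: "\<And>x y. x \<in> space MX \<Longrightarrow> y \<in> space MY \<Longrightarrow> 0 \<le> p_YX y x"
    and density_XY: "\<And>y. y \<in> space MY \<Longrightarrow> K_XY y = density MX (\<lambda>x. ennreal (p_XY x y))"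
    and density_YX: "\<And>x. x \<in> space MX \<Longrightarrow> K_YX x = density MY (\<lambda>y. ennreal (p_YX y x))"
    and q_measurable: "(\<lambda>(z, x, y). q z x y) \<in> borel_measurable (MX \<Otimes>\<^sub>M MX \<Otimes>\<^sub>M MY)"
    and q_nonneg: "\<And>z x y. z \<in> space MX \<Longrightarrow> x \<in> space MX \<Longrightarrow> y \<in> space MY \<Longrightarrow> 0 \<le> q z x y"
    and q_density: "\<And>x y. x \<in> space MX \<Longrightarrow> y \<in> space MY \<Longrightarrow> (\<integral>\<^sup>+z. ennreal (q z x y) \<partial>MX) = 1"
    and nontrivial_X: "\<exists>A1\<in>sets MX. \<exists>A2\<in>sets MX. A1 \<inter> A2 = {} \<and>
      0 < emeasure (distr J MX fst) A1 \<and> 0 < emeasure (distr J MX fst) A2"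
    and nontrivial_Y: "\<exists>B1\<in>sets MY. \<exists>B2\<in>sets MY. B1 \<inter> B2 = {} \<and>
      0 < emeasure (distr J MY snd) B1 \<and> 0 < emeasure (distr J MY snd) B2"

definition MH_accept ::
    "('a \<Rightarrow> 'b \<Rightarrow> real) \<Rightarrow> ('a \<Rightarrow> 'a \<Rightarrow> 'b \<Rightarrow> real) \<Rightarrow> 'a \<Rightarrow> 'a \<Rightarrow> 'b \<Rightarrow> real" where
  "MH_accept p_XY q z x y =
     (if p_XY x y * q z x y = 0 then 1
      else min 1 ((p_XY z y * q x z y) / (p_XY x y * q z x y)))"

definition P_MH ::
    "'a measure \<Rightarrow> ('a \<Rightarrow> 'b \<Rightarrow> real) \<Rightarrow> ('a \<Rightarrow> 'a \<Rightarrow> 'b \<Rightarrow> real) \<Rightarrow> 'a \<Rightarrow> 'b \<Rightarrow> 'a measure" where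
  "P_MH MX p_XY q x y =
     add_measure
       (density MX (\<lambda>x'. ennreal (q x' x y * MH_accept p_XY q x' x y)))
       (scale_measure (1 - (\<integral>\<^sup>+z. ennreal (q z x y * MH_accept p_XY q z x y) \<partial>MX)) (return MX x))"

definition P_DC ::
    "'a measure \<Rightarrow> 'b measure \<Rightarrow> ('a \<Rightarrow> 'b measure) \<Rightarrow> ('a \<Rightarrow> 'b \<Rightarrow> real) \<Rightarrow>
     ('a \<Rightarrow> 'a \<Rightarrow> 'b \<Rightarrow> real) \<Rightarrow> 'a \<times> 'b \<Rightarrow> ('a \<times> 'b) measure" where
  "P_DC MX MY K_YX p_XY q = (\<lambda>(x, y).
     K_YX x \<bind> (\<lambda>y'. distr (P_MH MX p_XY q x y') (MX \<Otimes>\<^sub>M MY) (\<lambda>x'. (x', y'))))"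

definition P_RC ::
    "'a measure \<Rightarrow> 'b measure \<Rightarrow> ('a \<Rightarrow> 'b measure) \<Rightarrow> ('a \<Rightarrow> 'b \<Rightarrow> real) \<Rightarrow>
     ('a \<Rightarrow> 'a \<Rightarrow> 'b \<Rightarrow> real) \<Rightarrow> real \<Rightarrow> 'a \<times> 'b \<Rightarrow> ('a \<times> 'b) measure" where
  "P_RC MX MY K_YX p_XY q r = (\<lambda>(x, y).
     add_measure
       (scale_measure (ennreal r) (distr (P_MH MX p_XY q x y) (MX \<Otimes>\<^sub>M MY) (\<lambda>x'. (x', y))))
       (scale_measure (ennreal (1 - r)) (distr (K_YX x) (MX \<Otimes>\<^sub>M MY) (\<lambda>y'. (x, y')))))"

end

theory Submission
  imports Defs
begin

text \<open>
  Let \<open>M\<close> be the operator of the Metropolis-Hastings update of \<open>x\<close> and \<open>E\<close> that of the Gibbs update of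
  \<open>y\<close>, acting on \<open>L\<^sup>2(J)\<close>. Both kernels are reversible with respect to \<open>J\<close>, the first by detailed
  balance. So both operators are self-adjoint contractions; \<open>E\<close> is moreover idempotent, being the
  conditional expectation given \<open>x\<close>. On densities, the deterministic scan acts by \<open>M E\<close> and the random
  scan by \<open>T = r M + (1 - r) E\<close> (\<open>density_kernel_compound\<close>, \<open>density_kernel_mixture\<close>). The distance
  between \<open>h dJ\<close> and \<open>J\<close> is \<open>\<parallel>h - 1\<parallel>\<close> (\<open>L2_dist_density\<close>), so rates are statements about the decay of
  \<open>\<parallel>A\<^sup>n h - 1\<parallel>\<close> for densities \<open>h\<close> and the operator \<open>A\<close> in question.

  A rate below 1 for the deterministic scan yields \<open>\<rho> < 1\<close> with \<open>\<parallel>(M E)\<^sup>n h - 1\<parallel> \<le> C \<rho>\<^sup>n\<close>, where \<open>C\<close>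
  depends on \<open>h\<close>. To remove this dependence one passes to the self-adjoint operator \<open>S = E M E\<close>, whose
  powers satisfy \<open>S\<^sup>n = E (M E)\<^sup>n\<close> for \<open>n \<ge> 1\<close>. Each \<open>g\<close> of mean zero is a multiple of a difference of two densities,
  so \<open>\<parallel>S\<^sup>n g\<parallel>\<close> decays like \<open>\<rho>\<^sup>n\<close>, still with a constant depending on \<open>g\<close>. But \<open>\<parallel>S\<^sup>n g\<parallel>\<^sup>2\<close> is a log-convex
  sequence, and for such a sequence the rate of decay bounds the very first ratio: \<open>\<parallel>S g\<parallel> \<le> \<rho> \<parallel>g\<parallel>\<close>
  (\<open>sandwich_norm_le\<close>).

  If \<open>\<parallel>T u\<parallel>\<close> were close to \<open>\<parallel>u\<parallel>\<close> for some \<open>u\<close> of mean zero, then \<open>M u\<close> and \<open>E u\<close> would have to be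
  nearly parallel and nearly as long as \<open>u\<close>; then \<open>u\<close> is close to \<open>E u\<close> and \<open>\<langle>u, S u\<rangle>\<close> is close to
  \<open>\<parallel>u\<parallel>\<^sup>2\<close>, which is excluded. Quantitatively, \<open>\<langle>M u, E u\<rangle> \<le> (1 - (1 - \<rho>)\<^sup>2 / 8) \<parallel>u\<parallel>\<^sup>2\<close>
  (\<open>inner_M_E_le\<close>), and the expansion of \<open>\<parallel>T u\<parallel>\<^sup>2\<close> shows that \<open>T\<close> contracts functions of mean zero by a
  factor below 1 (\<open>mixture_norm_le\<close>). Iterating bounds the rate of the random scan by this factor.
\<close>

section \<open>The geometry of square-integrable functions\<close>

lemma L2_measurable: "f \<in> L2 \<omega> \<Longrightarrow> f \<in> borel_measurable \<omega>"
  and L2_integrable_square: "f \<in> L2 \<omega> \<Longrightarrow> integrable \<omega> (\<lambda>z. (f z)\<^sup>2)"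
  by (auto simp: L2_def)

lemma L2_integrable_mult:
  assumes "f \<in> L2 \<omega>" "g \<in> L2 \<omega>"
  shows "integrable \<omega> (\<lambda>z. f z * g z)"
proof (rule Bochner_Integration.integrable_bound)
  show "integrable \<omega> (\<lambda>z. (f z)\<^sup>2 + (g z)\<^sup>2)"
    using assms by (auto simp: L2_def)
  show "(\<lambda>z. f z * g z) \<in> borel_measurable \<omega>"
    using assms by (auto simp: L2_def)
  show "AE z in \<omega>. norm (f z * g z) \<le> norm ((f z)\<^sup>2 + (g z)\<^sup>2)"
  proof (rule AE_I2)
    fix z
    have "2 * (\<bar>f z\<bar> * \<bar>g z\<bar>) \<le> \<bar>f z\<bar>\<^sup>2 + \<bar>g z\<bar>\<^sup>2"
      using sum_squares_bound[of "\<bar>f z\<bar>" "\<bar>g z\<bar>"] by (simp add: mult.assoc)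
    moreover have "0 \<le> \<bar>f z\<bar> * \<bar>g z\<bar>" by simp
    ultimately have "\<bar>f z\<bar> * \<bar>g z\<bar> \<le> (f z)\<^sup>2 + (g z)\<^sup>2"
      by (simp only: power2_abs)
    then show "norm (f z * g z) \<le> norm ((f z)\<^sup>2 + (g z)\<^sup>2)"
      by (simp add: abs_mult)
  qed
qed

lemma L2_scale: "f \<in> L2 \<omega> \<Longrightarrow> (\<lambda>z. c * f z) \<in> L2 \<omega>"
  by (auto simp: L2_def power_mult_distrib)

lemma L2_add:
  assumes "f \<in> L2 \<omega>" "g \<in> L2 \<omega>"
  shows "(\<lambda>z. f z + g z) \<in> L2 \<omega>"
  using assms L2_integrable_mult[OF assms]
  by (auto simp: L2_def power2_sum mult.assoc)

lemma L2_diff: "f \<in> L2 \<omega> \<Longrightarrow> g \<in> L2 \<omega> \<Longrightarrow> (\<lambda>z. f z - g z) \<in> L2 \<omega>"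
  using L2_add[of f \<omega> "\<lambda>z. - 1 * g z"] L2_scale[of g \<omega> "-1"] by simp

lemma (in finite_measure) L2_const: "(\<lambda>_. c) \<in> L2 M"
  by (simp add: L2_def)

lemma (in finite_measure) L2_integrable: "f \<in> L2 M \<Longrightarrow> integrable M f"
  using L2_integrable_mult[OF _ L2_const, of f 1] by simp

lemma L2_pos_part: "f \<in> L2 \<omega> \<Longrightarrow> (\<lambda>z. max 0 (f z)) \<in> L2 \<omega>"
  unfolding L2_def
  by (auto intro!: Bochner_Integration.integrable_bound[of _ "\<lambda>z. (f z)\<^sup>2" "\<lambda>z. (max 0 (f z))\<^sup>2"] AE_I2)
    (simp add: max_def)

lemma L2_norm_nonneg [simp]: "0 \<le> L2_norm \<omega> f"
  by (simp add: L2_norm_def)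

lemma L2_norm_square: "(L2_norm \<omega> f)\<^sup>2 = (\<integral>z. (f z)\<^sup>2 \<partial>\<omega>)"
  by (simp add: L2_norm_def)

lemma L2_norm_scale: "L2_norm \<omega> (\<lambda>z. c * f z) = \<bar>c\<bar> * L2_norm \<omega> f"
  by (simp add: L2_norm_def power_mult_distrib real_sqrt_mult)

lemma L2_norm_cong_AE:
  assumes "f \<in> borel_measurable \<omega>" "g \<in> borel_measurable \<omega>" "AE z in \<omega>. f z = g z"
  shows "L2_norm \<omega> f = L2_norm \<omega> g"
  unfolding L2_norm_def using assms by (intro arg_cong[of _ _ sqrt] integral_cong_AE) auto

text \<open>
  The middle step expands the squared norm of \<open>f - (b / c) g\<close>, the component of \<open>f\<close> orthogonal to \<open>g\<close>.
\<close>
lemma Cauchy_Schwarz_L2: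
  assumes f: "f \<in> L2 \<omega>" and g: "g \<in> L2 \<omega>"
  shows "\<bar>\<integral>z. f z * g z \<partial>\<omega>\<bar> \<le> L2_norm \<omega> f * L2_norm \<omega> g"
proof -
  define a b c where "a = (\<integral>z. (f z)\<^sup>2 \<partial>\<omega>)" and "b = (\<integral>z. f z * g z \<partial>\<omega>)"
    and "c = (\<integral>z. (g z)\<^sup>2 \<partial>\<omega>)"
  note int = L2_integrable_square[OF f] L2_integrable_square[OF g] L2_integrable_mult[OF f g]
  have "b\<^sup>2 \<le> a * c"
  proof (cases "c = 0")
    case True
    then have "AE z in \<omega>. g z = 0"
      unfolding c_def using int(2) by (subst (asm) integral_nonneg_eq_0_iff_AE) auto
    then have "b = 0"
      unfolding b_def using L2_measurable[OF f] L2_measurable[OF g]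
      by (subst integral_cong_AE[of _ _ "\<lambda>_. 0"]) auto
    then show ?thesis using True by simp
  next
    case False
    then have c: "0 < c" by (simp add: c_def less_le)
    have "(\<integral>z. (f z - b / c * g z)\<^sup>2 \<partial>\<omega>)
        = (\<integral>z. (f z)\<^sup>2 - 2 * (b / c) * (f z * g z) + (b / c)\<^sup>2 * (g z)\<^sup>2 \<partial>\<omega>)"
      by (intro Bochner_Integration.integral_cong) (auto simp: power2_eq_square algebra_simps)
    also have "\<dots> = a - 2 * (b / c) * b + (b / c)\<^sup>2 * c"
      unfolding a_def b_def c_def using int by simp
    also have "\<dots> = (a * c - b\<^sup>2) / c"
      using c by (simp add: field_simps power2_eq_square)
    finally have eq: "(\<integral>z. (f z - b / c * g z)\<^sup>2 \<partial>\<omega>) = (a * c - b\<^sup>2) / c" .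
    have "0 \<le> (a * c - b\<^sup>2) / c"
      unfolding eq[symmetric] by simp
    then show ?thesis using c by (simp add: zero_le_divide_iff)
  qed
  then have "sqrt (b\<^sup>2) \<le> sqrt (a * c)" by (rule real_sqrt_le_mono)
  then show ?thesis
    by (simp add: L2_norm_def real_sqrt_mult a_def b_def c_def)
qed

section \<open>Reversible kernels acting on functions\<close>

text \<open>
  As a Bochner integral this is 0 where \<open>f\<close> is not integrable with respect to \<open>K z\<close>. For integrable
  \<open>f\<close> and a kernel that preserves the underlying measure this happens only on a null set, which is
  why the algebraic identities below hold almost everywhere.
\<close>
definition kernel_op :: "('s \<Rightarrow> 's measure) \<Rightarrow> ('s \<Rightarrow> real) \<Rightarrow> 's \<Rightarrow> real" where
  "kernel_op K f z = (\<integral>w. f w \<partial>K z)"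

locale reversible_kernel = prob_space J for J :: "'s measure" +
  fixes K :: "'s \<Rightarrow> 's measure"
  assumes kernel: "K \<in> J \<rightarrow>\<^sub>M prob_algebra J"
    and reversible: "\<And>f g. f \<in> borel_measurable J \<Longrightarrow> g \<in> borel_measurable J \<Longrightarrow>
      (\<integral>\<^sup>+z. f z * (\<integral>\<^sup>+w. g w \<partial>K z) \<partial>J) = (\<integral>\<^sup>+z. (\<integral>\<^sup>+w. f w \<partial>K z) * g z \<partial>J)"
begin

lemma kernel_subprob: "K \<in> J \<rightarrow>\<^sub>M subprob_algebra J"
  using kernel by (rule measurable_prob_algebraD)

lemma
  assumes "z \<in> space J"
  shows prob_space_kernel: "prob_space (K z)" and sets_kernel: "sets (K z) = sets J"
  using measurable_space[OF kernel assms] by (auto simp: space_prob_algebra)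

lemma measurable_kernel:
  assumes "z \<in> space J" "f \<in> borel_measurable J" shows "f \<in> borel_measurable (K z)"
  using assms sets_kernel[OF assms(1)] by (simp cong: measurable_cong_sets)

lemma nn_measurable [measurable]:
  "f \<in> borel_measurable J \<Longrightarrow> (\<lambda>z. \<integral>\<^sup>+w. f w \<partial>K z) \<in> borel_measurable J"
  by (rule measurable_compose[OF kernel_subprob nn_integral_measurable_subprob_algebra])

lemma kernel_op_measurable [measurable]:
  "f \<in> borel_measurable J \<Longrightarrow> kernel_op K f \<in> borel_measurable J"
  unfolding kernel_op_def[abs_def]
  by (rule measurable_compose[OF kernel_subprob integral_measurable_subprob_algebra])

lemma invariant:
  assumes "g \<in> borel_measurable J"
  shows "(\<integral>\<^sup>+z. \<integral>\<^sup>+w. g w \<partial>K z \<partial>J) = (\<integral>\<^sup>+z. g z \<partial>J)"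
proof -
  have "(\<integral>\<^sup>+z. \<integral>\<^sup>+w. g w \<partial>K z \<partial>J) = (\<integral>\<^sup>+z. (\<integral>\<^sup>+w. 1 \<partial>K z) * g z \<partial>J)"
    using reversible[of "\<lambda>_. 1" g] assms by simp
  also have "\<dots> = (\<integral>\<^sup>+z. g z \<partial>J)"
    by (intro nn_integral_cong) (simp add: prob_space.emeasure_space_1[OF prob_space_kernel])
  finally show ?thesis .
qed

lemma AE_integrable_kernel:
  fixes f :: "'s \<Rightarrow> real"
  assumes f: "integrable J f"
  shows "AE z in J. integrable (K z) f"
proof -
  have [measurable]: "f \<in> borel_measurable J" using f by simp
  have "(\<integral>\<^sup>+z. \<integral>\<^sup>+w. ennreal (norm (f w)) \<partial>K z \<partial>J) < \<infinity>"
    using f unfolding integrable_iff_bounded by (subst invariant) simp_all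
  then have "AE z in J. (\<integral>\<^sup>+w. ennreal (norm (f w)) \<partial>K z) \<noteq> \<infinity>"
    by (intro nn_integral_PInf_AE) auto
  then show ?thesis
    by (rule AE_mp) (auto simp: integrable_iff_bounded less_top intro!: AE_I2 measurable_kernel)
qed

lemma kernel_op_const: "z \<in> space J \<Longrightarrow> kernel_op K (\<lambda>_. c) z = c"
  using prob_space.prob_space[OF prob_space_kernel, of z] by (simp add: kernel_op_def)

lemma kernel_op_diff:
  assumes "integrable J f" "integrable J g"
  shows "AE z in J. kernel_op K (\<lambda>w. f w - g w) z = kernel_op K f z - kernel_op K g z"
  using AE_integrable_kernel[OF assms(1)] AE_integrable_kernel[OF assms(2)]
  by eventually_elim (simp add: kernel_op_def)

lemma kernel_op_diff_const:
  assumes "integrable J f"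
  shows "AE z in J. kernel_op K (\<lambda>w. f w - c) z = kernel_op K f z - c"
  using kernel_op_diff[OF assms integrable_const] AE_space
  by eventually_elim (simp add: kernel_op_const)

lemma kernel_op_nonneg: "(\<And>w. 0 \<le> f w) \<Longrightarrow> 0 \<le> kernel_op K f z"
  by (simp add: kernel_op_def)

lemma nn_integral_eq_kernel_op:
  assumes "integrable J f" "\<And>w. 0 \<le> f w"
  shows "AE z in J. (\<integral>\<^sup>+w. ennreal (f w) \<partial>K z) = ennreal (kernel_op K f z)"
  using AE_integrable_kernel[OF assms(1)]
  by eventually_elim (simp add: kernel_op_def nn_integral_eq_integral assms(2))

text \<open>
  Jensen's inequality for the square. Stating it in the extended nonnegative reals lets it hold at
  every point: if \<open>f\<^sup>2\<close> is not integrable, the right-hand side is infinite.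
\<close>
lemma square_kernel_op_le:
  assumes z: "z \<in> space J" and [measurable]: "f \<in> borel_measurable J"
  shows "ennreal ((kernel_op K f z)\<^sup>2) \<le> (\<integral>\<^sup>+w. ennreal ((f w)\<^sup>2) \<partial>K z)"
proof -
  interpret Kz: prob_space "K z" by (rule prob_space_kernel[OF z])
  have fm: "f \<in> borel_measurable (K z)" using z assms(2) by (rule measurable_kernel)
  show ?thesis
  proof (cases "integrable (K z) (\<lambda>w. (f w)\<^sup>2)")
    case True
    then have L2: "f \<in> L2 (K z)" using fm by (simp add: L2_def)
    have "\<bar>\<integral>w. f w * 1 \<partial>K z\<bar> \<le> L2_norm (K z) f * L2_norm (K z) (\<lambda>_. 1)"
      by (rule Cauchy_Schwarz_L2[OF L2 Kz.L2_const])
    then have "\<bar>kernel_op K f z\<bar> \<le> L2_norm (K z) f"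
      by (simp add: kernel_op_def L2_norm_def[of _ "\<lambda>_. 1"] Kz.prob_space)
    then have "(kernel_op K f z)\<^sup>2 \<le> (\<integral>w. (f w)\<^sup>2 \<partial>K z)"
      using power_mono[of "\<bar>kernel_op K f z\<bar>" "L2_norm (K z) f" 2] by (simp add: L2_norm_square)
    then show ?thesis
      by (subst nn_integral_eq_integral[OF True]) (auto simp: ennreal_leI)
  next
    case False
    have "(\<integral>\<^sup>+w. ennreal ((f w)\<^sup>2) \<partial>K z) = \<infinity>"
    proof (rule ccontr)
      assume "(\<integral>\<^sup>+w. ennreal ((f w)\<^sup>2) \<partial>K z) \<noteq> \<infinity>"
      then have "integrable (K z) (\<lambda>w. (f w)\<^sup>2)"
        using fm by (simp add: integrable_iff_bounded less_top)
      with False show False ..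
    qed
    then show ?thesis by simp
  qed
qed

lemma nn_integral_square_kernel_op_le:
  assumes f: "f \<in> L2 J"
  shows "(\<integral>\<^sup>+z. ennreal ((kernel_op K f z)\<^sup>2) \<partial>J) \<le> ennreal (\<integral>z. (f z)\<^sup>2 \<partial>J)"
proof -
  have [measurable]: "f \<in> borel_measurable J" using f by (rule L2_measurable)
  have "(\<integral>\<^sup>+z. ennreal ((kernel_op K f z)\<^sup>2) \<partial>J) \<le> (\<integral>\<^sup>+z. \<integral>\<^sup>+w. ennreal ((f w)\<^sup>2) \<partial>K z \<partial>J)"
    by (intro nn_integral_mono square_kernel_op_le) auto
  also have "\<dots> = (\<integral>\<^sup>+z. ennreal ((f z)\<^sup>2) \<partial>J)"
    by (rule invariant) simp
  also have "\<dots> = ennreal (\<integral>z. (f z)\<^sup>2 \<partial>J)"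
    using f by (intro nn_integral_eq_integral) (auto simp: L2_def)
  finally show ?thesis .
qed

lemma kernel_op_L2:
  assumes f: "f \<in> L2 J"
  shows "kernel_op K f \<in> L2 J"
proof -
  have "(\<integral>\<^sup>+z. ennreal ((kernel_op K f z)\<^sup>2) \<partial>J) < \<infinity>"
    using nn_integral_square_kernel_op_le[OF f] by (rule le_less_trans) simp
  then show ?thesis
    using kernel_op_measurable[OF L2_measurable[OF f]]
    by (auto simp: L2_def integrable_iff_bounded)
qed

lemma kernel_op_contraction:
  assumes f: "f \<in> L2 J"
  shows "L2_norm J (kernel_op K f) \<le> L2_norm J f"
proof -
  have "ennreal (\<integral>z. (kernel_op K f z)\<^sup>2 \<partial>J) \<le> ennreal (\<integral>z. (f z)\<^sup>2 \<partial>J)"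
    using nn_integral_square_kernel_op_le[OF f] L2_integrable_square[OF kernel_op_L2[OF f]]
    by (subst (asm) nn_integral_eq_integral) auto
  then show ?thesis by (simp add: L2_norm_def)
qed

lemma symmetric_nonneg:
  assumes f: "f \<in> L2 J" "\<And>z. 0 \<le> f z" and g: "g \<in> L2 J" "\<And>z. 0 \<le> g z"
  shows "(\<integral>z. f z * kernel_op K g z \<partial>J) = (\<integral>z. kernel_op K f z * g z \<partial>J)"
proof -
  have [measurable]: "f \<in> borel_measurable J" "g \<in> borel_measurable J"
    using f g by (auto simp: L2_def)
  have "ennreal (\<integral>z. f z * kernel_op K g z \<partial>J) = (\<integral>\<^sup>+z. ennreal (f z * kernel_op K g z) \<partial>J)"
    using f g by (intro nn_integral_eq_integral[symmetric] L2_integrable_mult kernel_op_L2)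
      (auto simp: kernel_op_nonneg)
  also have "\<dots> = (\<integral>\<^sup>+z. ennreal (f z) * (\<integral>\<^sup>+w. ennreal (g w) \<partial>K z) \<partial>J)"
    using nn_integral_eq_kernel_op[OF L2_integrable[OF g(1)] g(2)]
    by (intro nn_integral_cong_AE, elim AE_mp) (auto simp: ennreal_mult f g kernel_op_nonneg)
  also have "\<dots> = (\<integral>\<^sup>+z. (\<integral>\<^sup>+w. ennreal (f w) \<partial>K z) * ennreal (g z) \<partial>J)"
    by (rule reversible) simp_all
  also have "\<dots> = (\<integral>\<^sup>+z. ennreal (kernel_op K f z * g z) \<partial>J)"
    using nn_integral_eq_kernel_op[OF L2_integrable[OF f(1)] f(2)]
    by (intro nn_integral_cong_AE, elim AE_mp) (auto simp: ennreal_mult f g kernel_op_nonneg)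
  also have "\<dots> = ennreal (\<integral>z. kernel_op K f z * g z \<partial>J)"
    using f g by (intro nn_integral_eq_integral L2_integrable_mult kernel_op_L2)
      (auto simp: kernel_op_nonneg)
  finally show ?thesis
    by (subst (asm) ennreal_inj)
      (auto intro!: integral_nonneg_AE AE_I2 mult_nonneg_nonneg simp: f g kernel_op_nonneg)
qed

lemma inner_kernel_op_diff:
  assumes "f \<in> L2 J" "a \<in> L2 J" "b \<in> L2 J"
  shows "(\<integral>z. f z * kernel_op K (\<lambda>w. a w - b w) z \<partial>J)
    = (\<integral>z. f z * kernel_op K a z \<partial>J) - (\<integral>z. f z * kernel_op K b z \<partial>J)"
proof -
  have [measurable]: "f \<in> borel_measurable J" "a \<in> borel_measurable J" "b \<in> borel_measurable J"
    using assms by (auto simp: L2_def)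
  have "(\<integral>z. f z * kernel_op K (\<lambda>w. a w - b w) z \<partial>J)
      = (\<integral>z. f z * kernel_op K a z - f z * kernel_op K b z \<partial>J)"
    using kernel_op_diff[OF L2_integrable[OF assms(2)] L2_integrable[OF assms(3)]]
    by (intro integral_cong_AE) (auto simp: right_diff_distrib)
  then show ?thesis
    using assms by (simp add: L2_integrable_mult kernel_op_L2)
qed

text \<open>
  For nonnegative functions the symmetry is the defining property of a reversible kernel. The
  general case follows by splitting both arguments into positive and negative parts.
\<close>
lemma symmetric:
  assumes f: "f \<in> L2 J" and g: "g \<in> L2 J"
  shows "(\<integral>z. f z * kernel_op K g z \<partial>J) = (\<integral>z. kernel_op K f z * g z \<partial>J)"
proof -
  define P where "P = (\<lambda>(h :: 's \<Rightarrow> real) z. max 0 (h z))"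
  define N where "N = (\<lambda>(h :: 's \<Rightarrow> real) z. max 0 (- h z))"
  have PN: "h = (\<lambda>z. P h z - N h z)" for h by (auto simp: P_def N_def)
  have nn: "0 \<le> P h z" "0 \<le> N h z" for h z by (auto simp: P_def N_def)
  have L2: "P h \<in> L2 J" "N h \<in> L2 J" if "h \<in> L2 J" for h
    using L2_pos_part[OF that] L2_pos_part[OF L2_scale[OF that, of "-1"]]
    by (auto simp: P_def N_def)
  have half: "(\<integral>z. a z * kernel_op K g z \<partial>J) = (\<integral>z. kernel_op K a z * g z \<partial>J)"
    if a: "a \<in> L2 J" "\<And>z. 0 \<le> a z" for a
  proof -
    have "(\<integral>z. a z * kernel_op K g z \<partial>J)
      = (\<integral>z. a z * kernel_op K (P g) z \<partial>J) - (\<integral>z. a z * kernel_op K (N g) z \<partial>J)"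
      by (subst PN) (rule inner_kernel_op_diff[OF a(1) L2[OF g]])
    also have "\<dots> = (\<integral>z. kernel_op K a z * P g z \<partial>J) - (\<integral>z. kernel_op K a z * N g z \<partial>J)"
      using a L2[OF g] nn by (simp add: symmetric_nonneg)
    also have "\<dots> = (\<integral>z. kernel_op K a z * (P g z - N g z) \<partial>J)"
      using a L2[OF g] by (simp add: right_diff_distrib L2_integrable_mult kernel_op_L2)
    finally show ?thesis using PN[of g] by metis
  qed
  have "(\<integral>z. kernel_op K f z * g z \<partial>J) = (\<integral>z. g z * kernel_op K (\<lambda>z. P f z - N f z) z \<partial>J)"
    by (simp add: mult.commute PN[symmetric])
  also have "\<dots> = (\<integral>z. g z * kernel_op K (P f) z \<partial>J) - (\<integral>z. g z * kernel_op K (N f) z \<partial>J)"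
    by (rule inner_kernel_op_diff[OF g L2[OF f]])
  also have "\<dots> = (\<integral>z. P f z * kernel_op K g z \<partial>J) - (\<integral>z. N f z * kernel_op K g z \<partial>J)"
    using half[OF L2(1)[OF f] nn(1)] half[OF L2(2)[OF f] nn(2)] by (simp add: mult.commute)
  also have "\<dots> = (\<integral>z. (P f z - N f z) * kernel_op K g z \<partial>J)"
    using L2[OF f] g by (simp add: left_diff_distrib L2_integrable_mult kernel_op_L2)
  finally show ?thesis using PN[of f] by metis
qed

lemma integral_kernel_op:
  assumes "f \<in> L2 J"
  shows "(\<integral>z. kernel_op K f z \<partial>J) = (\<integral>z. f z \<partial>J)"
proof -
  have "(\<integral>z. 1 * kernel_op K f z \<partial>J) = (\<integral>z. kernel_op K (\<lambda>_. 1) z * f z \<partial>J)"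
    by (rule symmetric[OF L2_const assms])
  also have "\<dots> = (\<integral>z. f z \<partial>J)"
    by (intro Bochner_Integration.integral_cong) (auto simp: kernel_op_const)
  finally show ?thesis by simp
qed

text \<open>
  Reversibility makes the action on measures and the action on functions coincide: one step of the
  chain carries the density \<open>h\<close> to \<open>K h\<close>.
\<close>
lemma bind_density:
  assumes h: "integrable J h" "\<And>z. 0 \<le> h z"
  shows "density J (\<lambda>z. ennreal (h z)) \<bind> K = density J (\<lambda>z. ennreal (kernel_op K h z))"
proof (rule measure_eqI)
  have [measurable]: "h \<in> borel_measurable J" using h by simp
  have K': "K \<in> density J (\<lambda>z. ennreal (h z)) \<rightarrow>\<^sub>M subprob_algebra J"
    using kernel_subprob by (simp cong: measurable_cong_sets)
  show sets: "sets (density J (\<lambda>z. ennreal (h z)) \<bind> K)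
      = sets (density J (\<lambda>z. ennreal (kernel_op K h z)))"
    using sets_kernel not_empty by (subst sets_bind[where N=J]) auto
  fix A assume "A \<in> sets (density J (\<lambda>z. ennreal (h z)) \<bind> K)"
  then have [measurable]: "A \<in> sets J" using sets by simp
  have "emeasure (density J (\<lambda>z. ennreal (h z)) \<bind> K) A
      = (\<integral>\<^sup>+z. emeasure (K z) A \<partial>density J (\<lambda>z. ennreal (h z)))"
    using not_empty by (intro emeasure_bind[OF _ K']) auto
  also have "\<dots> = (\<integral>\<^sup>+z. ennreal (h z) * (\<integral>\<^sup>+w. indicator A w \<partial>K z) \<partial>J)"
    by (subst nn_integral_density) (auto intro!: nn_integral_cong simp: sets_kernel
        measurable_compose[OF kernel_subprob measurable_emeasure_subprob_algebra])
  also have "\<dots> = (\<integral>\<^sup>+z. (\<integral>\<^sup>+w. ennreal (h w) \<partial>K z) * indicator A z \<partial>J)"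
    by (rule reversible) auto
  also have "\<dots> = (\<integral>\<^sup>+z. ennreal (kernel_op K h z) * indicator A z \<partial>J)"
    using nn_integral_eq_kernel_op[OF h]
    by (intro nn_integral_cong_AE, elim AE_mp) auto
  also have "\<dots> = emeasure (density J (\<lambda>z. ennreal (kernel_op K h z))) A"
    by (subst emeasure_density) auto
  finally show "emeasure (density J (\<lambda>z. ennreal (h z)) \<bind> K) A
      = emeasure (density J (\<lambda>z. ennreal (kernel_op K h z))) A" .
qed

end

section \<open>The convergence rate in terms of densities\<close>

text \<open>
  The values are required to be nonnegative everywhere, not just almost everywhere; \<open>kernel_op\<close>
  preserves this, and integrals of the representatives need no case distinctions on null sets.
\<close>
definition L2_densities :: "'s measure \<Rightarrow> ('s \<Rightarrow> real) set" where
  "L2_densities \<omega> = {h \<in> L2 \<omega>. (\<forall>z. 0 \<le> h z) \<and> (\<integral>z. h z \<partial>\<omega>) = 1}"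

lemma (in prob_space) density_minus_1_L2_0:
  assumes "h \<in> L2_densities M"
  shows "(\<lambda>z. h z - 1) \<in> L2_0 M"
  using assms L2_diff[OF _ L2_const, of h 1] L2_integrable[of h]
  by (auto simp: L2_densities_def L2_0_def prob_space)

text \<open>
  Paired with an \<open>f\<close> of mean zero, \<open>h\<close> and \<open>h - 1\<close> give the same number. So the distance is the norm
  of the functional \<open>f \<mapsto> \<langle>f, h - 1\<rangle>\<close> on \<open>L\<^sub>0\<^sup>2\<close>; by Cauchy-Schwarz that is the norm of
  \<open>h - 1\<close>, attained, unless it is 0, at \<open>h - 1\<close> itself after normalisation.
\<close>
lemma (in prob_space) L2_dist_density:
  assumes h: "h \<in> L2_densities M"
  shows "L2_dist M (density M (\<lambda>z. ennreal (h z))) M = ennreal (L2_norm M (\<lambda>z. h z - 1))"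
proof -
  define u where "u = (\<lambda>z. h z - 1)"
  have u: "u \<in> L2 M" "(\<integral>z. u z \<partial>M) = 0"
    using density_minus_1_L2_0[OF h] by (auto simp: u_def L2_0_def)
  have hL2: "h \<in> L2 M" and h0: "\<And>z. 0 \<le> h z"
    using h by (auto simp: L2_densities_def)
  have diff: "(\<integral>z. f z \<partial>density M (\<lambda>z. ennreal (h z))) - (\<integral>z. f z \<partial>M) = (\<integral>z. f z * u z \<partial>M)"
    if f: "f \<in> L2 M" for f
  proof -
    have "(\<integral>z. f z \<partial>density M (\<lambda>z. ennreal (h z))) = (\<integral>z. h z * f z \<partial>M)"
      using f hL2 h0 by (subst integral_density) (auto simp: L2_def)
    moreover have "(\<integral>z. f z * u z \<partial>M) = (\<integral>z. h z * f z \<partial>M) - (\<integral>z. f z \<partial>M)"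
      using L2_integrable_mult[OF hL2 f] L2_integrable[OF f]
      by (simp add: u_def algebra_simps)
    ultimately show ?thesis by simp
  qed
  have "L2_dist M (density M (\<lambda>z. ennreal (h z))) M
    = (SUP f\<in>{f \<in> L2_0 M. L2_norm M f = 1}. ennreal \<bar>\<integral>z. f z * u z \<partial>M\<bar>)"
    unfolding L2_dist_def
    by (intro SUP_cong refl arg_cong[where f="\<lambda>x. ennreal \<bar>x\<bar>"] diff) (simp add: L2_0_def)
  also have "\<dots> = ennreal (L2_norm M u)"
  proof (rule antisym)
    show "(SUP f\<in>{f \<in> L2_0 M. L2_norm M f = 1}. ennreal \<bar>\<integral>z. f z * u z \<partial>M\<bar>)
        \<le> ennreal (L2_norm M u)"
      using Cauchy_Schwarz_L2[OF _ u(1)] by (intro SUP_least ennreal_leI) (force simp: L2_0_def)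
    show "ennreal (L2_norm M u)
        \<le> (SUP f\<in>{f \<in> L2_0 M. L2_norm M f = 1}. ennreal \<bar>\<integral>z. f z * u z \<partial>M\<bar>)"
    proof (cases "L2_norm M u = 0")
      case False
      define n where "n = L2_norm M u"
      have n: "0 < n" using False by (simp add: n_def less_le)
      define f where "f = (\<lambda>z. inverse n * u z)"
      have "f \<in> L2_0 M" "L2_norm M f = 1"
        using n u by (auto simp: f_def L2_0_def L2_scale L2_norm_scale n_def)
      moreover have "(\<integral>z. f z * u z \<partial>M) = n"
      proof -
        have eq: "(\<integral>z. u z * u z \<partial>M) = n * n"
          using L2_norm_square[of M u] by (simp add: n_def power2_eq_square)
        have "(\<integral>z. f z * u z \<partial>M) = inverse n * (n * n)"
          by (simp add: f_def mult.assoc eq)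
        then show ?thesis using n by simp
      qed
      ultimately show ?thesis
        using n by (intro SUP_upper2[of f]) (auto simp: n_def[symmetric])
    qed simp
  qed
  finally show ?thesis by (simp add: u_def)
qed

text \<open>
  This trades Radon-Nikodym derivatives, which are extended real and determined only almost
  everywhere, for honest real functions.
\<close>
lemma (in prob_space) L2_star_eq_densities:
  "L2_star M = (\<lambda>h. density M (\<lambda>z. ennreal (h z))) ` L2_densities M"
proof (intro set_eqI iffI)
  fix \<mu> assume "\<mu> \<in> L2_star M"
  then interpret \<mu>: prob_space \<mu> by (simp add: L2_star_def)
  have sets: "sets \<mu> = sets M" and ac: "absolutely_continuous M \<mu>"
    and L2: "(\<lambda>z. enn2real (RN_deriv M \<mu> z)) \<in> L2 M"
    using \<open>\<mu> \<in> L2_star M\<close> by (auto simp: L2_star_def)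
  define h where "h = (\<lambda>z. enn2real (RN_deriv M \<mu> z))"
  have fin: "AE z in M. RN_deriv M \<mu> z \<noteq> \<infinity>"
    by (rule RN_deriv_finite[OF \<mu>.sigma_finite_measure ac sets])
  have eq: "\<mu> = density M (\<lambda>z. ennreal (h z))"
    using density_RN_deriv[OF ac sets] fin
    by (subst density_cong[of _ _ "RN_deriv M \<mu>"]) (auto simp: h_def less_top)
  have "(\<integral>z. h z \<partial>M) = 1"
  proof -
    have "ennreal (\<integral>z. h z \<partial>M) = (\<integral>\<^sup>+z. ennreal (h z) \<partial>M)"
      using L2_integrable[OF L2]
      by (intro nn_integral_eq_integral[symmetric]) (auto simp: h_def)
    also have "\<dots> = emeasure \<mu> (space \<mu>)"
      unfolding eq by (simp add: emeasure_density h_def cong: nn_integral_cong)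
    finally show ?thesis
      using \<mu>.emeasure_space_1 by simp
  qed
  then have "h \<in> L2_densities M"
    using L2 by (simp add: L2_densities_def h_def)
  then show "\<mu> \<in> (\<lambda>h. density M (\<lambda>z. ennreal (h z))) ` L2_densities M"
    using eq by blast
next
  fix \<mu> assume "\<mu> \<in> (\<lambda>h. density M (\<lambda>z. ennreal (h z))) ` L2_densities M"
  then obtain h where h: "h \<in> L2_densities M" and \<mu>: "\<mu> = density M (\<lambda>z. ennreal (h z))"
    by blast
  have [measurable]: "h \<in> borel_measurable M" and h0: "\<And>z. 0 \<le> h z" and L2: "h \<in> L2 M"
    and one: "(\<integral>z. h z \<partial>M) = 1"
    using h by (auto simp: L2_densities_def L2_def)
  have "prob_space \<mu>"
  proof
    have "emeasure \<mu> (space \<mu>) = (\<integral>\<^sup>+z. ennreal (h z) \<partial>M)"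
      unfolding \<mu> by (simp add: emeasure_density cong: nn_integral_cong)
    also have "\<dots> = 1"
      using h0 one by (subst nn_integral_eq_integral[OF L2_integrable[OF L2]]) auto
    finally show "emeasure \<mu> (space \<mu>) = 1" .
  qed
  then interpret \<mu>: prob_space \<mu> .
  have ac: "absolutely_continuous M \<mu>"
    unfolding \<mu> by (rule absolutely_continuousI_density) simp
  have "AE z in M. ennreal (h z) = RN_deriv M \<mu> z"
    by (rule RN_deriv_unique_sigma_finite) (simp_all add: \<mu>[symmetric] \<mu>.sigma_finite_measure)
  then have "AE z in M. (h z)\<^sup>2 = (enn2real (RN_deriv M \<mu> z))\<^sup>2"
    by eventually_elim (metis enn2real_ennreal h0)
  then have "integrable M (\<lambda>z. (enn2real (RN_deriv M \<mu> z))\<^sup>2)"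
    using L2_integrable_square[OF L2] by (subst integrable_cong_AE[of _ _ "\<lambda>z. (h z)\<^sup>2"]) auto
  then show "\<mu> \<in> L2_star M"
    using \<open>prob_space \<mu>\<close> ac by (auto simp: L2_star_def L2_def \<mu>)
qed

text \<open>
  The operator \<open>A\<close> describes one step of the chain on the level of densities. For \<open>P\<close> reversible it is
  the action of \<open>P\<close> on functions; for a composition it is the composition in reverse order, that is,
  the action of the adjoint.
\<close>
locale density_kernel = prob_space J for J :: "'s measure" +
  fixes P :: "'s \<Rightarrow> 's measure" and A :: "('s \<Rightarrow> real) \<Rightarrow> 's \<Rightarrow> real"
  assumes kernel: "P \<in> J \<rightarrow>\<^sub>M prob_algebra J"
    and A_densities: "\<And>h. h \<in> L2_densities J \<Longrightarrow> A h \<in> L2_densities J"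
    and A_bind: "\<And>h. h \<in> L2_densities J \<Longrightarrow>
      density J (\<lambda>z. ennreal (h z)) \<bind> P = density J (\<lambda>z. ennreal (A h z))"
begin

lemma iterate_densities: "h \<in> L2_densities J \<Longrightarrow> (A ^^ n) h \<in> L2_densities J"
  by (induction n) (auto intro: A_densities)

lemma kernel_pow_measurable: "kernel_pow J P n \<in> J \<rightarrow>\<^sub>M prob_algebra J"
proof (induction n)
  case (Suc n)
  then show ?case
    using measurable_bind_prob_space[OF Suc kernel] by simp
qed simp

lemma bind_kernel_pow:
  assumes h: "h \<in> L2_densities J"
  shows "density J (\<lambda>z. ennreal (h z)) \<bind> kernel_pow J P n
    = density J (\<lambda>z. ennreal ((A ^^ n) h z))"
proof (induction n)
  case 0
  show ?case by (simp add: bind_return'')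
next
  case (Suc n)
  have "density J (\<lambda>z. ennreal (h z)) \<bind> kernel_pow J P (Suc n)
      = (density J (\<lambda>z. ennreal (h z)) \<bind> kernel_pow J P n) \<bind> P"
    using measurable_prob_algebraD[OF kernel] measurable_prob_algebraD[OF kernel_pow_measurable]
    by (subst bind_assoc[where N=J and R=J]) (auto cong: measurable_cong_sets)
  then show ?case
    using A_bind[OF iterate_densities[OF h]] by (simp add: Suc)
qed

lemma L2_dist_iterate:
  assumes "h \<in> L2_densities J"
  shows "L2_dist J (density J (\<lambda>z. ennreal (h z)) \<bind> kernel_pow J P n) J
    = ennreal (L2_norm J (\<lambda>z. (A ^^ n) h z - 1))"
  using assms by (simp add: bind_kernel_pow L2_dist_density iterate_densities)

lemma L2_rate_eq:
  "L2_rate J P = Inf {\<rho>. 0 \<le> \<rho> \<and> \<rho> \<le> 1 \<and>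
    (\<forall>h\<in>L2_densities J. \<exists>C. \<forall>n\<ge>1. L2_norm J (\<lambda>z. (A ^^ n) h z - 1) < C * \<rho> ^ n)}"
proof -
  have "(\<exists>C. \<forall>n\<ge>1. ennreal (L2_norm J (\<lambda>z. (A ^^ n) h z - 1)) < ennreal (C * \<rho> ^ n))
    \<longleftrightarrow> (\<exists>C. \<forall>n\<ge>1. L2_norm J (\<lambda>z. (A ^^ n) h z - 1) < C * \<rho> ^ n)" for h \<rho>
    by (simp add: ennreal_less_iff)
  then show ?thesis
    unfolding L2_rate_def L2_star_eq_densities by (simp add: L2_dist_iterate cong: ball_cong conj_cong)
qed

lemma norm_iterate_le:
  assumes "0 \<le> \<gamma>" and "\<And>h. h \<in> L2_densities J \<Longrightarrow>
      L2_norm J (\<lambda>z. A h z - 1) \<le> \<gamma> * L2_norm J (\<lambda>z. h z - 1)"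
    and h: "h \<in> L2_densities J"
  shows "L2_norm J (\<lambda>z. (A ^^ n) h z - 1) \<le> \<gamma> ^ n * L2_norm J (\<lambda>z. h z - 1)"
proof (induction n)
  case (Suc n)
  have "L2_norm J (\<lambda>z. (A ^^ Suc n) h z - 1) \<le> \<gamma> * L2_norm J (\<lambda>z. (A ^^ n) h z - 1)"
    using assms(2)[OF iterate_densities[OF h]] by simp
  also have "\<dots> \<le> \<gamma> * (\<gamma> ^ n * L2_norm J (\<lambda>z. h z - 1))"
    using Suc assms(1) by (rule mult_left_mono)
  finally show ?case by (simp add: mult.assoc)
qed simp

text \<open>
  The definition of the rate asks for a strict inequality, which may fail for the obvious constant
  \<open>\<parallel>h - 1\<parallel>\<close> (for instance when \<open>h = 1\<close>); adding 1 repairs this because \<open>\<gamma>\<close> is positive.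
\<close>
lemma geometric_admissible:
  assumes "0 < \<gamma>" "\<gamma> \<le> 1" and "\<And>h. h \<in> L2_densities J \<Longrightarrow>
      L2_norm J (\<lambda>z. A h z - 1) \<le> \<gamma> * L2_norm J (\<lambda>z. h z - 1)"
  shows "\<gamma> \<in> {\<rho>. 0 \<le> \<rho> \<and> \<rho> \<le> 1 \<and>
    (\<forall>h\<in>L2_densities J. \<exists>C. \<forall>n\<ge>1. L2_norm J (\<lambda>z. (A ^^ n) h z - 1) < C * \<rho> ^ n)}"
proof -
  have "L2_norm J (\<lambda>z. (A ^^ n) h z - 1) < (L2_norm J (\<lambda>z. h z - 1) + 1) * \<gamma> ^ n"
    if "h \<in> L2_densities J" for h n
  proof -
    have "L2_norm J (\<lambda>z. (A ^^ n) h z - 1) \<le> \<gamma> ^ n * L2_norm J (\<lambda>z. h z - 1)"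
      using assms(1) by (intro norm_iterate_le assms(3) that) simp
    also have "\<dots> < (L2_norm J (\<lambda>z. h z - 1) + 1) * \<gamma> ^ n"
      using zero_less_power[OF assms(1), of n] by (simp add: algebra_simps)
    finally show ?thesis .
  qed
  then show ?thesis using assms(1,2) by force
qed

lemma L2_rate_le:
  assumes "0 < \<gamma>" "\<gamma> \<le> 1" and "\<And>h. h \<in> L2_densities J \<Longrightarrow>
      L2_norm J (\<lambda>z. A h z - 1) \<le> \<gamma> * L2_norm J (\<lambda>z. h z - 1)"
  shows "L2_rate J P \<le> \<gamma>"
  unfolding L2_rate_eq using geometric_admissible[OF assms]
  by (rule cInf_lower) (auto intro!: bdd_belowI[of _ 0])

text \<open>
  Nonexpansiveness makes \<open>\<rho> = 1\<close> admissible. The infimum is thus taken over a nonempty set, and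
  a value below 1 is witnessed by an admissible \<open>\<rho> < 1\<close>.
\<close>
lemma L2_rate_less_1D:
  assumes "L2_rate J P < 1" and "\<And>h. h \<in> L2_densities J \<Longrightarrow>
      L2_norm J (\<lambda>z. A h z - 1) \<le> L2_norm J (\<lambda>z. h z - 1)"
  obtains \<rho> where "0 \<le> \<rho>" "\<rho> < 1"
    "\<And>h. h \<in> L2_densities J \<Longrightarrow> \<exists>C. \<forall>n\<ge>1. L2_norm J (\<lambda>z. (A ^^ n) h z - 1) < C * \<rho> ^ n"
proof -
  let ?X = "{\<rho>. 0 \<le> \<rho> \<and> \<rho> \<le> 1 \<and>
    (\<forall>h\<in>L2_densities J. \<exists>C. \<forall>n\<ge>1. L2_norm J (\<lambda>z. (A ^^ n) h z - 1) < C * \<rho> ^ n)}"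
  have "(1::real) \<in> ?X" using assms(2) by (intro geometric_admissible) auto
  then obtain \<rho> where "\<rho> \<in> ?X" "\<rho> < 1"
    using cInf_lessD[of ?X 1] assms(1) unfolding L2_rate_eq by blast
  then show ?thesis using that by blast
qed

end

section \<open>From decay for each density to a spectral gap\<close>

text \<open>
  Log-convexity says that the ratios \<open>a (k + 1) / a k\<close> increase. If the first ratio exceeded \<open>\<sigma>\<close>, all
  of them would, and \<open>a\<close> would outgrow every multiple of \<open>\<sigma> ^ k\<close>. The constant \<open>C\<close> drops out: this is
  what turns decay with an uncontrolled constant into a bound on the first step.
\<close>
lemma log_convex_decay:
  fixes a :: "nat \<Rightarrow> real"
  assumes nonneg: "\<And>k. 0 \<le> a k" and convex: "\<And>k. (a (Suc k))\<^sup>2 \<le> a k * a (Suc (Suc k))"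
    and decay: "\<And>k. 1 \<le> k \<Longrightarrow> a k \<le> C * \<sigma> ^ k" and \<sigma>: "0 \<le> \<sigma>"
  shows "a 1 \<le> \<sigma> * a 0"
proof (rule ccontr)
  assume "\<not> a 1 \<le> \<sigma> * a 0"
  then have less: "\<sigma> * a 0 < a 1" by simp
  then have "0 < a 1" using nonneg[of 0] \<sigma> by (meson le_less_trans mult_nonneg_nonneg)
  then have "0 < (a 1)\<^sup>2" by simp
  also have "\<dots> \<le> a 0 * a 2" using convex[of 0] by (simp add: numeral_2_eq_2)
  finally have "0 < a 0 * a 2" .
  then have a0: "0 < a 0" using nonneg[of 0] by (auto simp: zero_less_mult_iff)
  define t where "t = a 1 / a 0"
  have t: "\<sigma> < t" using less a0 by (simp add: t_def field_simps)
  then have t0: "0 < t" using \<sigma> by simp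
  have step: "0 < a k \<and> t * a k \<le> a (Suc k)" for k
  proof (induction k)
    case 0
    then show ?case using a0 by (simp add: t_def)
  next
    case (Suc k)
    then have k: "0 < a k" "t * a k \<le> a (Suc k)" by auto
    then have Sk: "0 < a (Suc k)" using t0 by (meson less_le_trans mult_pos_pos)
    have "a k * (t * a (Suc k)) \<le> a (Suc k) * a (Suc k)"
      using mult_right_mono[OF k(2), of "a (Suc k)"] Sk by (simp add: algebra_simps)
    also have "\<dots> \<le> a k * a (Suc (Suc k))"
      using convex[of k] by (simp add: power2_eq_square)
    finally show ?case using k Sk by simp
  qed
  have ge: "t ^ k * a 0 \<le> a k" for k
  proof (induction k)
    case (Suc k)
    have "t ^ Suc k * a 0 \<le> t * a k" using Suc t0 by (simp add: mult.assoc)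
    then show ?case using step[of k] by linarith
  qed simp
  have "a 0 \<le> C * (\<sigma> / t) ^ k" if "1 \<le> k" for k
    using order_trans[OF ge decay[OF that]] t0 by (simp add: power_divide field_simps)
  moreover have "(\<lambda>k. C * (\<sigma> / t) ^ k) \<longlonglongrightarrow> C * 0"
    using t t0 \<sigma> by (intro tendsto_intros LIMSEQ_power_zero) auto
  ultimately have "a 0 \<le> C * 0"
    by (intro tendsto_lowerbound[of _ _ sequentially]) (auto simp: eventually_sequentially)
  then show False using a0 by simp
qed

context reversible_kernel
begin

lemma kernel_op_cong:
  assumes "z \<in> space J" "\<And>w. w \<in> space J \<Longrightarrow> f w = g w"
  shows "kernel_op K f z = kernel_op K g z"
  unfolding kernel_op_def using assms sets_eq_imp_space_eq[OF sets_kernel[OF assms(1)]]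
  by (intro Bochner_Integration.integral_cong) auto

lemma kernel_op_densities: "h \<in> L2_densities J \<Longrightarrow> kernel_op K h \<in> L2_densities J"
  by (simp add: L2_densities_def kernel_op_L2 integral_kernel_op kernel_op_nonneg)

lemma kernel_op_centered_contraction:
  assumes h: "h \<in> L2 J"
  shows "L2_norm J (\<lambda>z. kernel_op K h z - c) \<le> L2_norm J (\<lambda>z. h z - c)"
proof -
  have L2: "(\<lambda>z. h z - c) \<in> L2 J" by (rule L2_diff[OF h L2_const])
  have "L2_norm J (\<lambda>z. kernel_op K h z - c) = L2_norm J (kernel_op K (\<lambda>z. h z - c))"
    using kernel_op_diff_const[OF L2_integrable[OF h], of c] L2_measurable[OF h]
    by (intro L2_norm_cong_AE) (auto elim: AE_mp)
  then show ?thesis using kernel_op_contraction[OF L2] by simp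
qed

end

text \<open>
  Here \<open>M\<close> is the Metropolis-Hastings update and \<open>E\<close> the Gibbs update. Idempotence together with
  reversibility makes the action of \<open>E\<close> an orthogonal projection.
\<close>
locale scan_kernels = M: reversible_kernel J M + E: reversible_kernel J E
  for J :: "'s measure" and M E :: "'s \<Rightarrow> 's measure" +
  assumes idempotent: "\<And>f z. f \<in> borel_measurable J \<Longrightarrow> z \<in> space J \<Longrightarrow>
    kernel_op E (kernel_op E f) z = kernel_op E f z"
begin

text \<open>
  Densities evolve by adjoints: the step that runs first in time, \<open>E\<close>, is applied first, although the
  deterministic-scan kernel acts on test functions by \<open>E\<close> after \<open>M\<close>.
\<close>
definition compound :: "('s \<Rightarrow> real) \<Rightarrow> 's \<Rightarrow> real" where
  "compound h = kernel_op M (kernel_op E h)"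

text \<open>
  \<open>M E\<close> is not self-adjoint, but \<open>E M E\<close> is; since \<open>E\<close> is idempotent, their powers differ only by one
  outer factor \<open>E\<close>.
\<close>
definition sandwich :: "('s \<Rightarrow> real) \<Rightarrow> 's \<Rightarrow> real" where
  "sandwich h = kernel_op E (compound h)"

lemma compound_measurable: "h \<in> borel_measurable J \<Longrightarrow> compound h \<in> borel_measurable J"
  by (simp add: compound_def M.kernel_op_measurable E.kernel_op_measurable)

lemma compound_densities: "h \<in> L2_densities J \<Longrightarrow> compound h \<in> L2_densities J"
  by (simp add: compound_def M.kernel_op_densities E.kernel_op_densities)

lemma compound_contraction:
  assumes "h \<in> L2_densities J"
  shows "L2_norm J (\<lambda>z. compound h z - 1) \<le> L2_norm J (\<lambda>z. h z - 1)"
proof -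
  have h: "h \<in> L2 J" using assms by (simp add: L2_densities_def)
  show ?thesis
    unfolding compound_def
    using M.kernel_op_centered_contraction[OF E.kernel_op_L2[OF h]]
      E.kernel_op_centered_contraction[OF h] by (rule order_trans)
qed

lemma sandwich_L2: "h \<in> L2 J \<Longrightarrow> sandwich h \<in> L2 J"
  by (simp add: sandwich_def compound_def M.kernel_op_L2 E.kernel_op_L2)

lemma sandwich_pow_L2: "h \<in> L2 J \<Longrightarrow> (sandwich ^^ n) h \<in> L2 J"
  by (induction n) (auto intro: sandwich_L2)

lemma sandwich_symmetric:
  assumes f: "f \<in> L2 J" and g: "g \<in> L2 J"
  shows "(\<integral>z. f z * sandwich g z \<partial>J) = (\<integral>z. sandwich f z * g z \<partial>J)"
  using f g
  by (simp add: sandwich_def compound_def M.symmetric E.symmetric M.kernel_op_L2 E.kernel_op_L2)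

lemma sandwich_pow_symmetric:
  assumes f: "f \<in> L2 J" and g: "g \<in> L2 J"
  shows "(\<integral>z. f z * (sandwich ^^ n) g z \<partial>J) = (\<integral>z. (sandwich ^^ n) f z * g z \<partial>J)"
  using f
proof (induction n arbitrary: f)
  case (Suc n)
  have "(\<integral>z. f z * (sandwich ^^ Suc n) g z \<partial>J) = (\<integral>z. sandwich f z * (sandwich ^^ n) g z \<partial>J)"
    by (simp add: sandwich_symmetric[OF Suc.prems sandwich_pow_L2[OF g]])
  also have "\<dots> = (\<integral>z. (sandwich ^^ n) (sandwich f) z * g z \<partial>J)"
    by (rule Suc.IH[OF sandwich_L2[OF Suc.prems]])
  finally show ?case by (simp only: funpow_Suc_right o_apply)
qed simp

lemma sandwich_contraction: "h \<in> L2 J \<Longrightarrow> L2_norm J (sandwich h) \<le> L2_norm J h"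
  unfolding sandwich_def compound_def
  by (meson E.kernel_op_L2 E.kernel_op_contraction M.kernel_op_L2 M.kernel_op_contraction order_trans)

lemma sandwich_measurable: "h \<in> borel_measurable J \<Longrightarrow> sandwich h \<in> borel_measurable J"
  by (simp add: sandwich_def compound_measurable E.kernel_op_measurable)

lemma sandwich_pow_measurable: "h \<in> borel_measurable J \<Longrightarrow> (sandwich ^^ n) h \<in> borel_measurable J"
  by (induction n) (auto intro: sandwich_measurable)

lemma sandwich_cong:
  assumes "z \<in> space J" "\<And>w. w \<in> space J \<Longrightarrow> kernel_op E f w = kernel_op E g w"
  shows "sandwich f z = sandwich g z"
  unfolding sandwich_def compound_def
  by (intro E.kernel_op_cong M.kernel_op_cong assms)

lemma E_sandwich_pow:
  assumes "h \<in> borel_measurable J" "z \<in> space J"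
  shows "kernel_op E ((sandwich ^^ n) h) z = kernel_op E ((compound ^^ n) h) z"
  using assms(2)
proof (induction n arbitrary: z)
  case (Suc n)
  have "kernel_op E ((sandwich ^^ Suc n) h) z = kernel_op E (compound ((sandwich ^^ n) h)) z"
    using idempotent[OF compound_measurable[OF sandwich_pow_measurable[OF assms(1)]] Suc.prems]
    by (simp only: funpow.simps o_apply sandwich_def[of "(sandwich ^^ n) h"])
  also have "\<dots> = sandwich ((sandwich ^^ n) h) z" by (simp only: sandwich_def)
  also have "\<dots> = sandwich ((compound ^^ n) h) z"
    by (rule sandwich_cong[OF Suc.prems Suc.IH])
  finally show ?case by (simp add: sandwich_def[of "(compound ^^ n) h"])
qed simp

lemma sandwich_pow_eq:
  assumes "h \<in> borel_measurable J" "z \<in> space J" "1 \<le> n"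
  shows "(sandwich ^^ n) h z = kernel_op E ((compound ^^ n) h) z"
proof -
  obtain m where n: "n = Suc m" using assms(3) by (cases n) auto
  have "(sandwich ^^ n) h z = sandwich ((compound ^^ m) h) z"
    unfolding n using sandwich_cong[OF assms(2) E_sandwich_pow[OF assms(1)]] by simp
  then show ?thesis by (simp add: n sandwich_def)
qed

lemma compound_pow_densities: "h \<in> L2_densities J \<Longrightarrow> (compound ^^ n) h \<in> L2_densities J"
  by (induction n) (auto intro: compound_densities)

lemma sandwich_pow_norm_le:
  assumes h: "h \<in> L2_densities J" and n: "1 \<le> n"
  shows "L2_norm J (\<lambda>z. (sandwich ^^ n) h z - 1) \<le> L2_norm J (\<lambda>z. (compound ^^ n) h z - 1)"
proof -
  have L2: "(compound ^^ n) h \<in> L2 J" and hm: "h \<in> borel_measurable J"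
    using compound_pow_densities[OF h] h by (auto simp: L2_densities_def L2_def)
  have "L2_norm J (\<lambda>z. (sandwich ^^ n) h z - 1) = L2_norm J (\<lambda>z. kernel_op E ((compound ^^ n) h) z - 1)"
    unfolding L2_norm_def using sandwich_pow_eq[OF hm _ n]
    by (auto intro!: arg_cong[of _ _ sqrt] Bochner_Integration.integral_cong)
  then show ?thesis
    using E.kernel_op_centered_contraction[OF L2, of 1] by simp
qed

end

text \<open>
  Both parts of \<open>g\<close> have the same mass \<open>c\<close> because \<open>g\<close> has mean zero, so they can be normalised by the
  same factor. This spreads statements about densities to all of \<open>L\<^sub>0\<^sup>2\<close>.
\<close>
lemma (in prob_space) L2_0_decomposition:
  assumes g: "g \<in> L2_0 M" and ne: "L2_norm M g \<noteq> 0"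
  obtains c h1 h2 where "0 < c" "h1 \<in> L2_densities M" "h2 \<in> L2_densities M"
    "\<And>z. g z = c * (h1 z - h2 z)"
proof -
  have gL2: "g \<in> L2 M" and g0: "(\<integral>z. g z \<partial>M) = 0" using g by (auto simp: L2_0_def)
  define P where "P = (\<lambda>z. max 0 (g z))"
  define N where "N = (\<lambda>z. max 0 (- g z))"
  have L2: "P \<in> L2 M" "N \<in> L2 M"
    using L2_pos_part[OF gL2] L2_pos_part[OF L2_scale[OF gL2, of "-1"]] by (auto simp: P_def N_def)
  have PN: "g z = P z - N z" for z by (auto simp: P_def N_def)
  define c where "c = (\<integral>z. P z \<partial>M)"
  have c2: "c = (\<integral>z. N z \<partial>M)"
    using g0 L2_integrable[OF L2(1)] L2_integrable[OF L2(2)] by (simp add: PN c_def)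
  have nn: "0 \<le> P z" "0 \<le> N z" for z by (auto simp: P_def N_def)
  have "c \<noteq> 0"
  proof
    assume "c = 0"
    then have "AE z in M. P z = 0" "AE z in M. N z = 0"
      using integral_nonneg_eq_0_iff_AE[OF L2_integrable[OF L2(1)]] c2 nn
        integral_nonneg_eq_0_iff_AE[OF L2_integrable[OF L2(2)]] by (auto simp: c_def)
    then have "AE z in M. g z = 0" by eventually_elim (simp add: PN)
    then have "L2_norm M g = L2_norm M (\<lambda>_. 0)"
      using gL2 by (intro L2_norm_cong_AE) (auto simp: L2_def)
    then show False using ne by (simp add: L2_norm_def)
  qed
  then have c: "0 < c" using nn by (simp add: c_def less_le)
  show ?thesis
  proof (rule that[OF c])
    show "(\<lambda>z. inverse c * P z) \<in> L2_densities M" "(\<lambda>z. inverse c * N z) \<in> L2_densities M"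
      using c nn L2 c2[symmetric] c_def[symmetric] by (auto simp: L2_densities_def L2_scale)
    show "g z = c * (inverse c * P z - inverse c * N z)" for z
      using c by (simp add: PN right_diff_distrib mult.assoc[symmetric])
  qed
qed

context scan_kernels
begin

text \<open>
  Write \<open>S\<close> for the sandwich and \<open>g = c (h\<^sub>1 - h\<^sub>2)\<close>. Then
  \<open>\<parallel>S\<^sup>n g\<parallel>\<^sup>2 = \<langle>S\<^sup>2\<^sup>n g, g\<rangle> = c (\<langle>g, S\<^sup>2\<^sup>n h\<^sub>1\<rangle> - \<langle>g, S\<^sup>2\<^sup>n h\<^sub>2\<rangle>)\<close>, and each term is controlled by the
  convergence of a density to 1, as \<open>g\<close> is orthogonal to constants. Moving the powers of \<open>S\<close> over by
  symmetry avoids any appeal to the linearity of \<open>S\<close>, which holds only almost everywhere.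
\<close>
lemma sandwich_pow_decay:
  assumes decay: "\<And>h. h \<in> L2_densities J \<Longrightarrow>
      \<exists>C. \<forall>n\<ge>1. L2_norm J (\<lambda>z. (compound ^^ n) h z - 1) < C * \<rho> ^ n"
    and g: "g \<in> L2_0 J"
  shows "\<exists>C. \<forall>n\<ge>1. (L2_norm J ((sandwich ^^ n) g))\<^sup>2 \<le> C * (\<rho>\<^sup>2) ^ n"
proof (cases "L2_norm J g = 0")
  case True
  have gL2: "g \<in> L2 J" using g by (simp add: L2_0_def)
  have "L2_norm J ((sandwich ^^ n) g) \<le> 0" for n
  proof (induction n)
    case (Suc n)
    then show ?case
      using sandwich_contraction[OF sandwich_pow_L2[OF gL2, of n]] by simp
  qed (simp add: True)
  then have "(L2_norm J ((sandwich ^^ n) g))\<^sup>2 \<le> 0 * (\<rho>\<^sup>2) ^ n" for n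
    using L2_norm_nonneg[of J "(sandwich ^^ n) g"] antisym by fastforce
  then show ?thesis by blast
next
  case False
  obtain c h1 h2 where c: "0 < c" and h: "h1 \<in> L2_densities J" "h2 \<in> L2_densities J"
    and gh: "\<And>z. g z = c * (h1 z - h2 z)"
    using M.L2_0_decomposition[OF g False] by metis
  have gL2: "g \<in> L2 J" and g0: "(\<integral>z. g z \<partial>J) = 0" using g by (auto simp: L2_0_def)
  have hL2: "h1 \<in> L2 J" "h2 \<in> L2 J" using h by (auto simp: L2_densities_def)
  have pair: "\<exists>C. \<forall>n\<ge>1. \<bar>\<integral>z. g z * (sandwich ^^ n) h z \<partial>J\<bar> \<le> C * \<rho> ^ n"
    if h: "h \<in> L2_densities J" for h
  proof -
    obtain C where C: "\<And>n. 1 \<le> n \<Longrightarrow> L2_norm J (\<lambda>z. (compound ^^ n) h z - 1) < C * \<rho> ^ n"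
      using decay[OF h] by blast
    have hL2: "h \<in> L2 J" using h by (simp add: L2_densities_def)
    have "\<bar>\<integral>z. g z * (sandwich ^^ n) h z \<partial>J\<bar> \<le> (L2_norm J g * C) * \<rho> ^ n" if n: "1 \<le> n" for n
    proof -
      have SL2: "(sandwich ^^ n) h \<in> L2 J" by (rule sandwich_pow_L2[OF hL2])
      have "(\<integral>z. g z * (sandwich ^^ n) h z \<partial>J) = (\<integral>z. g z * ((sandwich ^^ n) h z - 1) \<partial>J)"
        using L2_integrable_mult[OF gL2 SL2] M.L2_integrable[OF gL2] g0
        by (simp add: right_diff_distrib)
      also have "\<bar>\<dots>\<bar> \<le> L2_norm J g * L2_norm J (\<lambda>z. (sandwich ^^ n) h z - 1)"
        by (rule Cauchy_Schwarz_L2[OF gL2 L2_diff[OF SL2 M.L2_const]])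
      also have "\<dots> \<le> L2_norm J g * (C * \<rho> ^ n)"
        using sandwich_pow_norm_le[OF h n] C[OF n] by (intro mult_left_mono) auto
      finally show ?thesis by (simp add: mult.assoc)
    qed
    then show ?thesis by blast
  qed
  obtain C1 C2 where C: "\<And>n. 1 \<le> n \<Longrightarrow> \<bar>\<integral>z. g z * (sandwich ^^ n) h1 z \<partial>J\<bar> \<le> C1 * \<rho> ^ n"
    "\<And>n. 1 \<le> n \<Longrightarrow> \<bar>\<integral>z. g z * (sandwich ^^ n) h2 z \<partial>J\<bar> \<le> C2 * \<rho> ^ n"
    using pair[OF h(1)] pair[OF h(2)] by blast
  have "(L2_norm J ((sandwich ^^ n) g))\<^sup>2 \<le> (c * (C1 + C2)) * (\<rho>\<^sup>2) ^ n" if n: "1 \<le> n" for n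
  proof -
    let ?S = "(sandwich ^^ (n + n)) g"
    have SL2: "?S \<in> L2 J" by (rule sandwich_pow_L2[OF gL2])
    have "(L2_norm J ((sandwich ^^ n) g))\<^sup>2 = (\<integral>z. (sandwich ^^ n) g z * (sandwich ^^ n) g z \<partial>J)"
      unfolding L2_norm_square by (simp add: power2_eq_square)
    also have "\<dots> = (\<integral>z. ?S z * g z \<partial>J)"
      by (simp add: sandwich_pow_symmetric[OF sandwich_pow_L2[OF gL2] gL2] funpow_add)
    also have "\<dots> = (\<integral>z. c * (?S z * h1 z - ?S z * h2 z) \<partial>J)"
      by (intro Bochner_Integration.integral_cong) (auto simp: gh[of _] algebra_simps simp del: funpow.simps)
    also have "\<dots> = c * ((\<integral>z. ?S z * h1 z \<partial>J) - (\<integral>z. ?S z * h2 z \<partial>J))"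
      using L2_integrable_mult[OF SL2 hL2(1)] L2_integrable_mult[OF SL2 hL2(2)] by simp
    also have "\<dots> = c * ((\<integral>z. g z * (sandwich ^^ (n + n)) h1 z \<partial>J)
        - (\<integral>z. g z * (sandwich ^^ (n + n)) h2 z \<partial>J))"
      by (simp only: sandwich_pow_symmetric[OF gL2 hL2(1)] sandwich_pow_symmetric[OF gL2 hL2(2)])
    also have "\<dots> \<le> c * (C1 * \<rho> ^ (n + n) + C2 * \<rho> ^ (n + n))"
      using C(1)[of "n + n"] C(2)[of "n + n"] n c by (intro mult_left_mono) auto
    also have "\<dots> = (c * (C1 + C2)) * (\<rho>\<^sup>2) ^ n"
      by (simp add: power2_eq_square power_mult_distrib power_add algebra_simps)
    finally show ?thesis .
  qed
  then show ?thesis by blast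
qed

text \<open>
  The moments \<open>\<parallel>S\<^sup>k g\<parallel>\<^sup>2 = \<langle>S\<^sup>k\<^sup>-\<^sup>1 g, S\<^sup>k\<^sup>+\<^sup>1 g\<rangle>\<close> of a self-adjoint operator are log-convex by
  Cauchy-Schwarz. Hence the geometric decay, whose constant depends on \<open>g\<close>, already gives a norm bound;
  this replaces the uniform boundedness principle.
\<close>
lemma sandwich_norm_le:
  assumes decay: "\<And>h. h \<in> L2_densities J \<Longrightarrow>
      \<exists>C. \<forall>n\<ge>1. L2_norm J (\<lambda>z. (compound ^^ n) h z - 1) < C * \<rho> ^ n"
    and \<rho>: "0 \<le> \<rho>" and g: "g \<in> L2_0 J"
  shows "L2_norm J (sandwich g) \<le> \<rho> * L2_norm J g"
proof -
  define a where "a = (\<lambda>n. (L2_norm J ((sandwich ^^ n) g))\<^sup>2)"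
  obtain C where C: "\<And>n. 1 \<le> n \<Longrightarrow> a n \<le> C * (\<rho>\<^sup>2) ^ n"
    using sandwich_pow_decay[OF decay g] unfolding a_def by blast
  have gL2: "g \<in> L2 J" using g by (simp add: L2_0_def)
  have "(a (Suc k))\<^sup>2 \<le> a k * a (Suc (Suc k))" for k
  proof -
    let ?S = "\<lambda>n. (sandwich ^^ n) g"
    note S = sandwich_pow_L2[OF gL2]
    have "a (Suc k) = (\<integral>z. sandwich (?S k) z * ?S (Suc k) z \<partial>J)"
      unfolding a_def L2_norm_square by (simp add: power2_eq_square)
    also have "\<dots> = (\<integral>z. ?S k z * ?S (Suc (Suc k)) z \<partial>J)"
      using sandwich_symmetric[OF S[of k] S[of "Suc k"]] by simp
    finally have "\<bar>a (Suc k)\<bar> \<le> L2_norm J (?S k) * L2_norm J (?S (Suc (Suc k)))"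
      using Cauchy_Schwarz_L2[OF S[of k] S[of "Suc (Suc k)"]] by simp
    then have "\<bar>a (Suc k)\<bar>\<^sup>2 \<le> (L2_norm J (?S k) * L2_norm J (?S (Suc (Suc k))))\<^sup>2"
      by (rule power_mono) simp
    then show ?thesis by (simp add: a_def power_mult_distrib)
  qed
  then have "a 1 \<le> \<rho>\<^sup>2 * a 0"
    by (intro log_convex_decay[where C=C]) (auto simp: a_def C[unfolded a_def])
  then have "(L2_norm J (sandwich g))\<^sup>2 \<le> (\<rho> * L2_norm J g)\<^sup>2"
    by (simp add: a_def power_mult_distrib)
  then show ?thesis by (rule power2_le_imp_le) (simp add: \<rho>)
qed

text \<open>
  Let \<open>v = E u\<close>, \<open>n = \<parallel>u\<parallel>\<close>, \<open>c = \<parallel>v\<parallel>\<close> and \<open>m = \<langle>M u, v\<rangle>\<close>. There are two bounds. Cauchy-Schwarz gives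
  \<open>m \<le> n c\<close>, good when \<open>u\<close> is far from the range of \<open>E\<close>. Splitting
  \<open>m = \<langle>v, M v\<rangle> + \<langle>u - v, M v\<rangle>\<close> gives \<open>m \<le> \<rho> n\<^sup>2 + n \<parallel>u - v\<parallel>\<close>, because
  \<open>\<langle>v, M v\<rangle> = \<langle>u, E M E u\<rangle>\<close>; this is good when \<open>u\<close> is close to its projection. By Pythagoras,
  \<open>\<parallel>u - v\<parallel>\<^sup>2 = n\<^sup>2 - c\<^sup>2\<close>, so they cannot both be bad.
\<close>
lemma inner_M_E_le:
  assumes sandwich: "L2_norm J (sandwich u) \<le> \<rho> * L2_norm J u"
    and \<rho>: "0 \<le> \<rho>" "\<rho> \<le> 1" and u: "u \<in> L2 J"
  shows "(\<integral>z. kernel_op M u z * kernel_op E u z \<partial>J) \<le> (1 - (1 - \<rho>)\<^sup>2 / 8) * (L2_norm J u)\<^sup>2"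
proof -
  define v where "v = kernel_op E u"
  define n where "n = L2_norm J u"
  define c where "c = L2_norm J v"
  define m where "m = (\<integral>z. kernel_op M u z * v z \<partial>J)"
  define \<delta> where "\<delta> = (1 - \<rho>)\<^sup>2 / 8"
  have v: "v \<in> L2 J" unfolding v_def by (rule E.kernel_op_L2[OF u])
  have n0: "0 \<le> n" and c0: "0 \<le> c" by (simp_all add: n_def c_def)
  have "m \<le> L2_norm J (kernel_op M u) * c"
    unfolding m_def c_def using Cauchy_Schwarz_L2[OF M.kernel_op_L2[OF u] v] by linarith
  also have "\<dots> \<le> n * c"
    unfolding n_def using c0 M.kernel_op_contraction[OF u] by (rule mult_right_mono[rotated])
  finally have m1: "m \<le> n * c" .
  have uv: "(\<integral>z. u z * v z \<partial>J) = c\<^sup>2"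
  proof -
    have "(\<integral>z. u z * v z \<partial>J) = (\<integral>z. u z * kernel_op E v z \<partial>J)"
      using idempotent[OF L2_measurable[OF u]]
      by (intro Bochner_Integration.integral_cong) (auto simp: v_def)
    also have "\<dots> = (\<integral>z. v z * v z \<partial>J)"
      using E.symmetric[OF u v] by (simp add: v_def)
    finally show ?thesis unfolding c_def L2_norm_square by (simp add: power2_eq_square)
  qed
  have "(L2_norm J (\<lambda>z. u z - v z))\<^sup>2 = (\<integral>z. (u z)\<^sup>2 - 2 * (u z * v z) + (v z)\<^sup>2 \<partial>J)"
    unfolding L2_norm_square
    by (intro Bochner_Integration.integral_cong) (auto simp: power2_diff)
  also have "\<dots> = n\<^sup>2 - 2 * c\<^sup>2 + c\<^sup>2"
    using L2_integrable_mult[OF u v] L2_integrable_square[OF u] L2_integrable_square[OF v]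
    by (simp add: uv) (simp add: n_def c_def L2_norm_square)
  finally have d: "(L2_norm J (\<lambda>z. u z - v z))\<^sup>2 = n\<^sup>2 - c\<^sup>2" by simp
  define s where "s = L2_norm J (\<lambda>z. u z - v z)"
  have s0: "0 \<le> s" by (simp add: s_def)
  have Mv: "kernel_op M v \<in> L2 J" by (rule M.kernel_op_L2[OF v])
  have "m = (\<integral>z. u z * kernel_op M v z \<partial>J)"
    unfolding m_def by (rule M.symmetric[OF u v, symmetric])
  also have "\<dots> = (\<integral>z. v z * kernel_op M v z + (u z - v z) * kernel_op M v z \<partial>J)"
    by (simp add: algebra_simps)
  also have "\<dots> = (\<integral>z. v z * kernel_op M v z \<partial>J) + (\<integral>z. (u z - v z) * kernel_op M v z \<partial>J)"
    using L2_integrable_mult[OF v Mv] L2_integrable_mult[OF L2_diff[OF u v] Mv] by simp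
  also have "(\<integral>z. v z * kernel_op M v z \<partial>J) = (\<integral>z. u z * sandwich u z \<partial>J)"
    unfolding sandwich_def compound_def v_def
    by (rule E.symmetric[OF u Mv[unfolded v_def], symmetric])
  also have "\<dots> \<le> n * (\<rho> * n)"
    using Cauchy_Schwarz_L2[OF u sandwich_L2[OF u]] mult_left_mono[OF sandwich n0]
    by (simp add: n_def)
  also have "(\<integral>z. (u z - v z) * kernel_op M v z \<partial>J) \<le> s * n"
  proof -
    have "(\<integral>z. (u z - v z) * kernel_op M v z \<partial>J) \<le> s * L2_norm J (kernel_op M v)"
      using Cauchy_Schwarz_L2[OF L2_diff[OF u v] Mv] by (simp add: s_def)
    also have "\<dots> \<le> s * n"
      using M.kernel_op_contraction[OF v] E.kernel_op_contraction[OF u] s0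
      by (intro mult_left_mono) (auto simp: n_def v_def)
    finally show ?thesis .
  qed
  finally have m2: "m \<le> n * (\<rho> * n) + s * n" by simp
  have "m \<le> (1 - \<delta>) * n\<^sup>2"
  proof (rule ccontr)
    assume "\<not> m \<le> (1 - \<delta>) * n\<^sup>2"
    then have less: "(1 - \<delta>) * n * n < m" by (simp add: power2_eq_square)
    have n: "0 < n"
      using less m1 n0 by (cases "n = 0") auto
    have r1: "(1 - \<rho>)\<^sup>2 \<le> 1 - \<rho>"
      using \<rho> mult_left_mono[of "1 - \<rho>" 1 "1 - \<rho>"] by (simp add: power2_eq_square)
    have \<delta>: "0 \<le> \<delta>" "\<delta> \<le> (1 - \<rho>) / 8" using r1 by (auto simp: \<delta>_def)
    (* If m is near its maximum, so is c by the first bound, hence u - v is short. The constant 8 in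
       \<delta> makes the square root of 2 \<delta> equal to (1 - \<rho>) / 2, half of what the second bound leaves. *)
    have "(1 - \<delta>) * n < c"
      using less m1 n by (smt (verit) mult.commute mult_less_cancel_left_pos)
    then have "((1 - \<delta>) * n)\<^sup>2 < c\<^sup>2"
      using n \<delta> \<rho> by (intro power_strict_mono) auto
    moreover have "(1 - 2 * \<delta>) * n\<^sup>2 \<le> ((1 - \<delta>) * n)\<^sup>2"
      unfolding power_mult_distrib by (intro mult_right_mono) (auto simp: power2_eq_square algebra_simps)
    ultimately have "s\<^sup>2 \<le> 2 * \<delta> * n\<^sup>2"
      using d by (simp add: s_def algebra_simps)
    also have "\<dots> = ((1 - \<rho>) / 2 * n)\<^sup>2"
      by (simp add: \<delta>_def power_mult_distrib power_divide)
    finally have "s \<le> (1 - \<rho>) / 2 * n"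
      by (rule power2_le_imp_le) (use n \<rho> in simp)
    then have "s * n \<le> (1 - \<rho>) / 2 * n * n" using n by (intro mult_right_mono) auto
    then have "(1 - \<delta>) * n * n < n * (\<rho> * n) + (1 - \<rho>) / 2 * n * n"
      using less m2 by linarith
    then have "(1 - \<delta>) * (n * n) < (\<rho> + (1 - \<rho>) / 2) * (n * n)"
      by (simp only: distrib_left distrib_right ac_simps)
    then have "1 - \<delta> < \<rho> + (1 - \<rho>) / 2" using n by simp
    then show False using \<delta> \<rho> by (simp add: field_simps)
  qed
  then show ?thesis by (simp add: m_def v_def n_def \<delta>_def)
qed

definition mixture :: "real \<Rightarrow> ('s \<Rightarrow> real) \<Rightarrow> 's \<Rightarrow> real" where
  "mixture r h z = r * kernel_op M h z + (1 - r) * kernel_op E h z"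

text \<open>
  Expanding the square, the coefficients \<open>r\<^sup>2\<close>, \<open>2 r (1 - r)\<close> and \<open>(1 - r)\<^sup>2\<close> add up to 1, so any loss
  in the cross term \<open>\<langle>M u, E u\<rangle>\<close> is a loss for the whole.
\<close>
lemma mixture_norm_le:
  assumes sandwich: "L2_norm J (sandwich u) \<le> \<rho> * L2_norm J u"
    and \<rho>: "0 \<le> \<rho>" "\<rho> \<le> 1" and r: "0 \<le> r" "r \<le> 1" and u: "u \<in> L2 J"
  shows "L2_norm J (mixture r u) \<le> sqrt (1 - 2 * r * (1 - r) * ((1 - \<rho>)\<^sup>2 / 8)) * L2_norm J u"
proof -
  define n where "n = (L2_norm J u)\<^sup>2"
  let ?m = "\<integral>z. kernel_op M u z * kernel_op E u z \<partial>J"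
  have Mu: "kernel_op M u \<in> L2 J" and Eu: "kernel_op E u \<in> L2 J"
    using u by (auto intro: M.kernel_op_L2 E.kernel_op_L2)
  have "(L2_norm J (mixture r u))\<^sup>2 = (\<integral>z. r\<^sup>2 * (kernel_op M u z)\<^sup>2
      + 2 * r * (1 - r) * (kernel_op M u z * kernel_op E u z) + (1 - r)\<^sup>2 * (kernel_op E u z)\<^sup>2 \<partial>J)"
    unfolding L2_norm_square mixture_def
    by (intro Bochner_Integration.integral_cong) (auto simp: power2_sum power_mult_distrib)
  also have "\<dots> = r\<^sup>2 * (L2_norm J (kernel_op M u))\<^sup>2 + 2 * r * (1 - r) * ?m
      + (1 - r)\<^sup>2 * (L2_norm J (kernel_op E u))\<^sup>2"
    using L2_integrable_mult[OF Mu Eu] L2_integrable_square[OF Mu] L2_integrable_square[OF Eu]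
    by (simp add: L2_norm_square)
  also have "\<dots> \<le> r\<^sup>2 * n + 2 * r * (1 - r) * ((1 - (1 - \<rho>)\<^sup>2 / 8) * n) + (1 - r)\<^sup>2 * n"
    using M.kernel_op_contraction[OF u] E.kernel_op_contraction[OF u]
      inner_M_E_le[OF sandwich \<rho> u] r
    unfolding n_def by (intro add_mono mult_left_mono power_mono) auto
  also have "\<dots> = (1 - 2 * r * (1 - r) * ((1 - \<rho>)\<^sup>2 / 8)) * n"
    by (simp add: power2_eq_square algebra_simps)
  finally have "sqrt ((L2_norm J (mixture r u))\<^sup>2)
      \<le> sqrt ((1 - 2 * r * (1 - r) * ((1 - \<rho>)\<^sup>2 / 8)) * n)"
    by (rule real_sqrt_le_mono)
  then show ?thesis by (simp add: real_sqrt_mult n_def)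
qed

lemma mixture_densities:
  assumes "h \<in> L2_densities J" "0 \<le> r" "r \<le> 1"
  shows "mixture r h \<in> L2_densities J"
proof -
  have Mh: "kernel_op M h \<in> L2_densities J" and Eh: "kernel_op E h \<in> L2_densities J"
    by (rule M.kernel_op_densities[OF assms(1)], rule E.kernel_op_densities[OF assms(1)])
  then have L2: "kernel_op M h \<in> L2 J" "kernel_op E h \<in> L2 J"
    by (simp_all add: L2_densities_def)
  show ?thesis
    using Mh Eh assms(2,3) M.L2_integrable[OF L2(1)] M.L2_integrable[OF L2(2)]
      L2_add[OF L2_scale[OF L2(1)] L2_scale[OF L2(2)], of r "1 - r"]
    by (simp add: L2_densities_def mixture_def[abs_def])
qed

lemma mixture_centered_norm_le:
  assumes sandwich: "\<And>u. u \<in> L2_0 J \<Longrightarrow> L2_norm J (sandwich u) \<le> \<rho> * L2_norm J u"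
    and \<rho>: "0 \<le> \<rho>" "\<rho> \<le> 1" and r: "0 \<le> r" "r \<le> 1" and h: "h \<in> L2_densities J"
  shows "L2_norm J (\<lambda>z. mixture r h z - 1)
    \<le> sqrt (1 - 2 * r * (1 - r) * ((1 - \<rho>)\<^sup>2 / 8)) * L2_norm J (\<lambda>z. h z - 1)"
proof -
  have hL2: "h \<in> L2 J" using h by (simp add: L2_densities_def)
  have u: "(\<lambda>z. h z - 1) \<in> L2_0 J" by (rule M.density_minus_1_L2_0[OF h])
  then have uL2: "(\<lambda>z. h z - 1) \<in> L2 J" by (simp add: L2_0_def)
  have "AE z in J. mixture r h z - 1 = mixture r (\<lambda>z. h z - 1) z"
    using M.kernel_op_diff_const[OF M.L2_integrable[OF hL2], of 1]
      E.kernel_op_diff_const[OF M.L2_integrable[OF hL2], of 1]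
  proof eventually_elim
    case (elim z)
    then show ?case by (simp only: mixture_def) (simp add: algebra_simps)
  qed
  then have "L2_norm J (\<lambda>z. mixture r h z - 1) = L2_norm J (mixture r (\<lambda>z. h z - 1))"
    using L2_measurable[OF hL2] L2_measurable[OF uL2]
    by (intro L2_norm_cong_AE)
      (simp_all add: mixture_def[abs_def] M.kernel_op_measurable E.kernel_op_measurable)
  then show ?thesis
    using mixture_norm_le[OF sandwich[OF u] \<rho> r uL2] by simp
qed

lemma density_kernel_compound:
  assumes D: "\<And>z. z \<in> space J \<Longrightarrow> D z = E z \<bind> M"
  shows "density_kernel J D compound"
proof
  have "(\<lambda>z. E z \<bind> M) \<in> J \<rightarrow>\<^sub>M prob_algebra J"
    by (rule measurable_bind_prob_space[OF E.kernel M.kernel])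
  then show "D \<in> J \<rightarrow>\<^sub>M prob_algebra J"
    by (subst measurable_cong[OF D])
  fix h assume h: "h \<in> L2_densities J"
  show "compound h \<in> L2_densities J" by (rule compound_densities[OF h])
  have Eh: "kernel_op E h \<in> L2_densities J" by (rule E.kernel_op_densities[OF h])
  have "density J (\<lambda>z. ennreal (h z)) \<bind> D
      = density J (\<lambda>z. ennreal (h z)) \<bind> (\<lambda>z. E z \<bind> M)"
    by (rule bind_cong) (auto simp: D)
  also have "\<dots> = (density J (\<lambda>z. ennreal (h z)) \<bind> E) \<bind> M"
    by (rule bind_assoc[symmetric, where N=J and R=J])
      (use E.kernel_subprob M.kernel_subprob in \<open>simp_all cong: measurable_cong_sets\<close>)
  also have "\<dots> = density J (\<lambda>z. ennreal (compound h z))"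
    using h Eh M.L2_integrable
    by (simp add: E.bind_density M.bind_density L2_densities_def compound_def)
  finally show "density J (\<lambda>z. ennreal (h z)) \<bind> D = density J (\<lambda>z. ennreal (compound h z))" .
qed

lemma density_kernel_mixture:
  assumes sets_R: "\<And>z. z \<in> space J \<Longrightarrow> sets (R z) = sets J"
    and R: "\<And>z A. z \<in> space J \<Longrightarrow> A \<in> sets J \<Longrightarrow>
      emeasure (R z) A = ennreal r * emeasure (M z) A + ennreal (1 - r) * emeasure (E z) A"
    and r: "0 \<le> r" "r \<le> 1"
  shows "density_kernel J R (mixture r)"
proof
  have emeas: "(\<lambda>z. emeasure (M z) A) \<in> borel_measurable J" "(\<lambda>z. emeasure (E z) A) \<in> borel_measurable J"
    if "A \<in> sets J" for A
    using that measurable_compose[OF M.kernel_subprob measurable_emeasure_subprob_algebra]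
      measurable_compose[OF E.kernel_subprob measurable_emeasure_subprob_algebra] by auto
  have prob: "prob_space (R z)" if z: "z \<in> space J" for z
  proof
    have sp: "space (R z) = space J" "space (M z) = space J" "space (E z) = space J"
      using sets_R[OF z] M.sets_kernel[OF z] E.sets_kernel[OF z] by (auto dest: sets_eq_imp_space_eq)
    have "emeasure (R z) (space J) = ennreal r + ennreal (1 - r)"
      using R[OF z, of "space J"] prob_space.emeasure_space_1[OF M.prob_space_kernel[OF z]]
        prob_space.emeasure_space_1[OF E.prob_space_kernel[OF z]] by (simp add: sp)
    also have "\<dots> = 1" using r by (simp add: ennreal_plus[symmetric] del: ennreal_plus)
    finally show "emeasure (R z) (space (R z)) = 1" by (simp add: sp)
  qed
  show kernel: "R \<in> J \<rightarrow>\<^sub>M prob_algebra J"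
  proof (intro measurable_prob_algebraI measurable_subprob_algebra)
    fix A assume A: "A \<in> sets J"
    show "(\<lambda>z. emeasure (R z) A) \<in> borel_measurable J"
      using emeas[OF A] by (subst measurable_cong[OF R[OF _ A]]) auto
  qed (simp_all add: prob prob_space_imp_subprob_space sets_R)
  fix h assume h: "h \<in> L2_densities J"
  then have hL2: "h \<in> L2 J" and h0: "\<And>z. 0 \<le> h z" by (auto simp: L2_densities_def)
  show "mixture r h \<in> L2_densities J" using h r by (rule mixture_densities)
  have [measurable]: "kernel_op M h \<in> borel_measurable J" "kernel_op E h \<in> borel_measurable J"
    using L2_measurable[OF hL2] by (auto intro: M.kernel_op_measurable E.kernel_op_measurable)
  let ?\<nu> = "density J (\<lambda>z. ennreal (h z))"
  have R': "R \<in> ?\<nu> \<rightarrow>\<^sub>M subprob_algebra J" "M \<in> ?\<nu> \<rightarrow>\<^sub>M subprob_algebra J" "E \<in> ?\<nu> \<rightarrow>\<^sub>M subprob_algebra J"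
    using measurable_prob_algebraD[OF kernel] M.kernel_subprob E.kernel_subprob
    by (simp_all cong: measurable_cong_sets)
  have ne: "space ?\<nu> \<noteq> {}" using M.not_empty by simp
  show "?\<nu> \<bind> R = density J (\<lambda>z. ennreal (mixture r h z))"
  proof (rule measure_eqI)
    show sets: "sets (?\<nu> \<bind> R) = sets (density J (\<lambda>z. ennreal (mixture r h z)))"
      using sets_R ne by (subst sets_bind[where N=J]) auto
    fix A assume "A \<in> sets (?\<nu> \<bind> R)"
    then have A[measurable]: "A \<in> sets J" using sets by simp
    have "emeasure (?\<nu> \<bind> R) A = (\<integral>\<^sup>+z. emeasure (R z) A \<partial>?\<nu>)"
      by (rule emeasure_bind[OF ne R'(1) A])
    also have "\<dots> = (\<integral>\<^sup>+z. ennreal r * emeasure (M z) A + ennreal (1 - r) * emeasure (E z) A \<partial>?\<nu>)"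
      by (intro nn_integral_cong) (simp add: R)
    also have "\<dots> = ennreal r * (\<integral>\<^sup>+z. emeasure (M z) A \<partial>?\<nu>)
        + ennreal (1 - r) * (\<integral>\<^sup>+z. emeasure (E z) A \<partial>?\<nu>)"
      using emeas[OF A] by (subst nn_integral_add) (simp_all add: nn_integral_cmult)
    also have "\<dots> = ennreal r * emeasure (?\<nu> \<bind> M) A + ennreal (1 - r) * emeasure (?\<nu> \<bind> E) A"
      by (simp only: emeasure_bind[OF ne R'(2) A] emeasure_bind[OF ne R'(3) A])
    also have "\<dots> = ennreal r * (\<integral>\<^sup>+z. ennreal (kernel_op M h z) * indicator A z \<partial>J)
        + ennreal (1 - r) * (\<integral>\<^sup>+z. ennreal (kernel_op E h z) * indicator A z \<partial>J)"
      using M.L2_integrable[OF hL2] h0 by (simp add: M.bind_density E.bind_density emeasure_density)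
    also have "\<dots> = (\<integral>\<^sup>+z. ennreal r * (ennreal (kernel_op M h z) * indicator A z)
        + ennreal (1 - r) * (ennreal (kernel_op E h z) * indicator A z) \<partial>J)"
      by (subst nn_integral_add) (simp_all add: nn_integral_cmult)
    also have "\<dots> = (\<integral>\<^sup>+z. ennreal (mixture r h z) * indicator A z \<partial>J)"
      using r M.kernel_op_nonneg[OF h0] E.kernel_op_nonneg[OF h0]
      by (intro nn_integral_cong) (simp add: mixture_def ennreal_mult indicator_def)
    also have "\<dots> = emeasure (density J (\<lambda>z. ennreal (mixture r h z))) A"
      by (subst emeasure_density) (simp_all add: mixture_def[abs_def])
    finally show "emeasure (?\<nu> \<bind> R) A = emeasure (density J (\<lambda>z. ennreal (mixture r h z))) A" .
  qed
qed

text \<open>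
  The factor \<open>sqrt (1 - \<epsilon>)\<close> has to be positive as well as below 1, since a positive rate is what a
  geometric bound with a strict inequality needs; therefore \<open>\<epsilon> < 1\<close> is checked too.
\<close>
theorem rate_less_1_transfer:
  assumes DC: "density_kernel J D compound"
    and RC: "density_kernel J R (mixture r)"
    and r: "0 < r" "r < 1" and rate: "L2_rate J D < 1"
  shows "L2_rate J R < 1"
proof -
  interpret D: density_kernel J D compound by (rule DC)
  interpret R: density_kernel J R "mixture r" by (rule RC)
  obtain \<rho> where \<rho>: "0 \<le> \<rho>" "\<rho> < 1"
    and decay: "\<And>h. h \<in> L2_densities J \<Longrightarrow>
      \<exists>C. \<forall>n\<ge>1. L2_norm J (\<lambda>z. (compound ^^ n) h z - 1) < C * \<rho> ^ n"
    using D.L2_rate_less_1D[OF rate compound_contraction] by blast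
  define \<epsilon> where "\<epsilon> = 2 * r * (1 - r) * ((1 - \<rho>)\<^sup>2 / 8)"
  have "0 < \<epsilon>" using r \<rho> by (simp add: \<epsilon>_def)
  moreover have "\<epsilon> < 1"
  proof -
    have "r * (1 - r) \<le> 1 * 1" using r by (intro mult_mono) auto
    moreover have "(1 - \<rho>)\<^sup>2 \<le> 1\<^sup>2" using \<rho> by (intro power_mono) auto
    ultimately have "(r * (1 - r)) * (1 - \<rho>)\<^sup>2 \<le> 1 * 1"
      using r by (intro mult_mono) auto
    then show ?thesis by (simp add: \<epsilon>_def)
  qed
  ultimately have \<gamma>: "0 < sqrt (1 - \<epsilon>)" "sqrt (1 - \<epsilon>) < 1" by auto
  have "L2_rate J R \<le> sqrt (1 - \<epsilon>)"
  proof (rule R.L2_rate_le)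
    show "L2_norm J (\<lambda>z. mixture r h z - 1) \<le> sqrt (1 - \<epsilon>) * L2_norm J (\<lambda>z. h z - 1)"
      if "h \<in> L2_densities J" for h
      unfolding \<epsilon>_def using \<rho> r that
      by (intro mixture_centered_norm_le sandwich_norm_le[OF decay]) auto
  qed (use \<gamma> in auto)
  then show ?thesis using \<gamma>(2) by (rule le_less_trans)
qed

end

section \<open>Sums of measures and disintegration\<close>

lemma nn_integral_add_measure:
  assumes sets: "sets M = sets N" and f: "f \<in> borel_measurable M"
  shows "(\<integral>\<^sup>+x. f x \<partial>add_measure M N) = (\<integral>\<^sup>+x. f x \<partial>M) + (\<integral>\<^sup>+x. f x \<partial>N)"
  using f
proof induction
  case (cong f g)
  have "space N = space M" using sets by (auto dest: sets_eq_imp_space_eq)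
  then show ?case
    using cong by (simp cong: nn_integral_cong_simp)
next
  case (set A)
  then show ?case using sets by (simp add: emeasure_add_measure)
next
  case (mult u c)
  then have "u \<in> borel_measurable N" "u \<in> borel_measurable (add_measure M N)"
    using sets by (simp_all cong: measurable_cong_sets)
  then show ?case
    using mult by (simp add: nn_integral_cmult distrib_left)
next
  case (add u v)
  then have "u \<in> borel_measurable N" "u \<in> borel_measurable (add_measure M N)"
    "v \<in> borel_measurable N" "v \<in> borel_measurable (add_measure M N)"
    using sets by (simp_all cong: measurable_cong_sets)
  then show ?case
    using add by (simp add: nn_integral_add ac_simps)
next
  case (seq U)
  then have *: "U i \<in> borel_measurable N" "U i \<in> borel_measurable (add_measure M N)" for i
    using sets by (simp_all cong: measurable_cong_sets)
  have "incseq (\<lambda>i. \<integral>\<^sup>+x. U i x \<partial>M)" "incseq (\<lambda>i. \<integral>\<^sup>+x. U i x \<partial>N)"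
    using seq(3) by (auto simp: incseq_def le_fun_def intro!: nn_integral_mono)
  then show ?case
    using seq * by (simp add: image_comp nn_integral_monotone_convergence_SUP ennreal_SUP_add)
qed

lemma measure_eqI_rectangles:
  assumes "sets M = sets (M1 \<Otimes>\<^sub>M M2)" "sets N = sets (M1 \<Otimes>\<^sub>M M2)"
    and "emeasure M (space M) \<noteq> \<infinity>"
    and eq: "\<And>A B. A \<in> sets M1 \<Longrightarrow> B \<in> sets M2 \<Longrightarrow> emeasure M (A \<times> B) = emeasure N (A \<times> B)"
  shows "M = N"
proof (rule measure_eqI_generator_eq[OF Int_stable_pair_measure_generator pair_measure_closed])
  show "sets M = sigma_sets (space M1 \<times> space M2) {a \<times> b | a b. a \<in> sets M1 \<and> b \<in> sets M2}"
    "sets N = sigma_sets (space M1 \<times> space M2) {a \<times> b | a b. a \<in> sets M1 \<and> b \<in> sets M2}"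
    using assms(1,2) by (simp_all add: sets_pair_measure)
  have "space M = space M1 \<times> space M2"
    using sets_eq_imp_space_eq[OF assms(1)] by (simp add: space_pair_measure)
  then show "emeasure M ((\<lambda>_::nat. space M1 \<times> space M2) i) \<noteq> \<infinity>" for i
    using assms(3) by simp
qed (auto simp: eq)

lemma nn_integral_disintegration:
  assumes J: "prob_space J" and sets_J: "sets J = sets (M1 \<Otimes>\<^sub>M M2)"
    and K: "K \<in> M1 \<rightarrow>\<^sub>M prob_algebra M2"
    and cond: "\<And>A B. A \<in> sets M1 \<Longrightarrow> B \<in> sets M2 \<Longrightarrow>
      emeasure J (A \<times> B) = (\<integral>\<^sup>+x\<in>A. emeasure (K x) B \<partial>distr J M1 fst)"
    and f: "f \<in> borel_measurable (M1 \<Otimes>\<^sub>M M2)"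
  shows "(\<integral>\<^sup>+z. f z \<partial>J) = (\<integral>\<^sup>+x. \<integral>\<^sup>+y. f (x, y) \<partial>K x \<partial>distr J M1 fst)"
proof -
  interpret J: prob_space J by (rule J)
  note K[measurable] sets_J[measurable_cong] f[measurable]
  let ?L = "\<lambda>x. distr (K x) (M1 \<Otimes>\<^sub>M M2) (\<lambda>y. (x, y))"
  let ?N = "distr J M1 fst \<bind> ?L"
  have L: "?L \<in> distr J M1 fst \<rightarrow>\<^sub>M prob_algebra (M1 \<Otimes>\<^sub>M M2)"
    by measurable
  have sets_K: "sets (K x) = sets M2" if "x \<in> space M1" for x
    using measurable_space[OF K that] by (simp add: space_prob_algebra)
  have "J = ?N"
  proof (rule measure_eqI_rectangles)
    have "distr J M1 fst \<in> space (prob_algebra (distr J M1 fst))"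
      by (auto simp: space_prob_algebra intro!: J.prob_space_distr)
    note emeas = emeasure_bind_prob_algebra[OF this L]
    have "space M1 \<noteq> {}"
      using J.not_empty sets_eq_imp_space_eq[OF sets_J] by (auto simp: space_pair_measure)
    then show "sets ?N = sets (M1 \<Otimes>\<^sub>M M2)"
      by (intro sets_bind) auto
    fix A B assume A[measurable]: "A \<in> sets M1" and B[measurable]: "B \<in> sets M2"
    have "emeasure ?N (A \<times> B) = (\<integral>\<^sup>+x. emeasure (?L x) (A \<times> B) \<partial>distr J M1 fst)"
      by (rule emeas) simp
    also have "\<dots> = (\<integral>\<^sup>+x\<in>A. emeasure (K x) B \<partial>distr J M1 fst)"
    proof (intro nn_integral_cong)
      fix x assume "x \<in> space (distr J M1 fst)"
      then have x: "x \<in> space M1" by simp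
      note sets_K[OF x, measurable_cong]
      have "(\<lambda>y. (x, y)) -` (A \<times> B) \<inter> space (K x) = (if x \<in> A then B else {})"
        using sets.sets_into_space[OF B] sets_eq_imp_space_eq[OF sets_K[OF x]] by auto
      then show "emeasure (?L x) (A \<times> B) = emeasure (K x) B * indicator A x"
        using x by (subst emeasure_distr) auto
    qed
    also have "\<dots> = emeasure J (A \<times> B)"
      by (rule cond[symmetric]) simp_all
    finally show "emeasure J (A \<times> B) = emeasure ?N (A \<times> B)" ..
  qed (auto simp: sets_J J.emeasure_space_1)
  then have "(\<integral>\<^sup>+z. f z \<partial>J) = (\<integral>\<^sup>+z. f z \<partial>?N)" by simp
  also have "\<dots> = (\<integral>\<^sup>+x. \<integral>\<^sup>+z. f z \<partial>?L x \<partial>distr J M1 fst)"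
    by (rule nn_integral_bind[OF f measurable_prob_algebraD[OF L]])
  also have "\<dots> = (\<integral>\<^sup>+x. \<integral>\<^sup>+y. f (x, y) \<partial>K x \<partial>distr J M1 fst)"
  proof (intro nn_integral_cong)
    fix x assume "x \<in> space (distr J M1 fst)"
    then have x: "x \<in> space M1" by simp
    note sets_K[OF x, measurable_cong]
    show "(\<integral>\<^sup>+z. f z \<partial>?L x) = (\<integral>\<^sup>+y. f (x, y) \<partial>K x)"
      using x by (subst nn_integral_distr) auto
  qed
  finally show ?thesis .
qed

section \<open>The Metropolis-Hastings and Gibbs updates\<close>

lemma MH_accept_nonneg:
  assumes "0 \<le> p z y" "0 \<le> p x y" "0 \<le> q x z y" "0 \<le> q z x y"
  shows "0 \<le> MH_accept p q z x y" "MH_accept p q z x y \<le> 1"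
  using assms by (auto simp: MH_accept_def)

text \<open>
  The right-hand side is symmetric in \<open>x\<close> and \<open>z\<close>. It also covers a vanishing denominator: then the
  left-hand side is 0, whatever the acceptance probability, and so is the minimum.
\<close>
lemma MH_detailed_balance:
  assumes "0 \<le> p z y" "0 \<le> p x y" "0 \<le> q x z y" "0 \<le> q z x y"
  shows "p x y * (q z x y * MH_accept p q z x y) = min (p x y * q z x y) (p z y * q x z y)"
proof (cases "p x y * q z x y = 0")
  case True
  then show ?thesis using assms by (auto simp: min_def)
next
  case False
  then have pos: "0 < p x y * q z x y" using assms by (auto simp: less_le)
  have "p x y * (q z x y * MH_accept p q z x y)
      = (p x y * q z x y) * min 1 ((p z y * q x z y) / (p x y * q z x y))"
    using False by (simp add: MH_accept_def mult.assoc)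
  also have "\<dots> = min (p x y * q z x y) (p z y * q x z y)"
  proof -
    have "a * min 1 (b / a) = min a b" if "0 < a" for a b :: real
      using that by (auto simp: min_def field_simps)
    from this[OF pos] show ?thesis .
  qed
  finally show ?thesis .
qed

context cond_MH_setting
begin

text \<open>The density of accepted proposals; its total mass is the overall acceptance probability.\<close>
definition move_density :: "'a \<Rightarrow> 'a \<Rightarrow> 'b \<Rightarrow> real" where
  "move_density x' x y = q x' x y * MH_accept p_XY q x' x y"

lemma move_density_measurable [measurable]:
  assumes [measurable]: "f \<in> N \<rightarrow>\<^sub>M MX" "g \<in> N \<rightarrow>\<^sub>M MX" "h \<in> N \<rightarrow>\<^sub>M MY"
  shows "(\<lambda>w. move_density (f w) (g w) (h w)) \<in> borel_measurable N"
proof -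
  have [measurable]: "(\<lambda>w. q (f w) (g w) (h w)) \<in> borel_measurable N"
    "(\<lambda>w. q (g w) (f w) (h w)) \<in> borel_measurable N"
    using measurable_compose[OF _ q_measurable, of "\<lambda>w. (f w, g w, h w)" N]
      measurable_compose[OF _ q_measurable, of "\<lambda>w. (g w, f w, h w)" N] by simp_all
  have [measurable]: "(\<lambda>w. p_XY (f w) (h w)) \<in> borel_measurable N"
    "(\<lambda>w. p_XY (g w) (h w)) \<in> borel_measurable N"
    using measurable_compose[OF _ p_XY_measurable, of "\<lambda>w. (f w, h w)" N]
      measurable_compose[OF _ p_XY_measurable, of "\<lambda>w. (g w, h w)" N] by simp_all
  show ?thesis
    unfolding move_density_def MH_accept_def by measurable
qed

lemma move_density_nonneg: "x' \<in> space MX \<Longrightarrow> x \<in> space MX \<Longrightarrow> y \<in> space MY \<Longrightarrow> 0 \<le> move_density x' x y"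
  and move_density_le: "x' \<in> space MX \<Longrightarrow> x \<in> space MX \<Longrightarrow> y \<in> space MY \<Longrightarrow> move_density x' x y \<le> q x' x y"
  unfolding move_density_def
  using MH_accept_nonneg[of p_XY x' y x q] p_XY_nonneg q_nonneg
  by (auto intro: mult_left_le)

lemma move_density_balance:
  assumes "x' \<in> space MX" "x \<in> space MX" "y \<in> space MY"
  shows "p_XY x y * move_density x' x y = p_XY x' y * move_density x x' y"
  unfolding move_density_def using assms
  by (simp add: MH_detailed_balance p_XY_nonneg q_nonneg min.commute)

definition rejection :: "'a \<Rightarrow> 'b \<Rightarrow> ennreal" where
  "rejection x y = 1 - (\<integral>\<^sup>+z. ennreal (move_density z x y) \<partial>MX)"

lemma move_density_integral_le_1:
  assumes "x \<in> space MX" "y \<in> space MY"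
  shows "(\<integral>\<^sup>+z. ennreal (move_density z x y) \<partial>MX) \<le> 1"
proof -
  have "(\<integral>\<^sup>+z. ennreal (move_density z x y) \<partial>MX) \<le> (\<integral>\<^sup>+z. ennreal (q z x y) \<partial>MX)"
    using assms by (intro nn_integral_mono ennreal_leI move_density_le) auto
  then show ?thesis using q_density[OF assms] by simp
qed

lemma sets_P_MH [simp, measurable_cong]: "sets (P_MH MX p_XY q x y) = sets MX"
  by (simp add: P_MH_def)

lemma nn_integral_P_MH:
  assumes xy: "x \<in> space MX" "y \<in> space MY" and g[measurable]: "g \<in> borel_measurable MX"
  shows "(\<integral>\<^sup>+x'. g x' \<partial>P_MH MX p_XY q x y)
    = (\<integral>\<^sup>+x'. ennreal (move_density x' x y) * g x' \<partial>MX) + rejection x y * g x"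
proof -
  have [measurable]: "(\<lambda>x'. move_density x' x y) \<in> borel_measurable MX"
    using xy by measurable
  have "(\<integral>\<^sup>+x'. g x' \<partial>P_MH MX p_XY q x y)
      = (\<integral>\<^sup>+x'. g x' \<partial>density MX (\<lambda>x'. ennreal (move_density x' x y)))
        + (\<integral>\<^sup>+x'. g x' \<partial>scale_measure (rejection x y) (return MX x))"
    unfolding P_MH_def move_density_def[symmetric] rejection_def[symmetric]
    by (rule nn_integral_add_measure) simp_all
  also have "\<dots> = (\<integral>\<^sup>+x'. ennreal (move_density x' x y) * g x' \<partial>MX) + rejection x y * g x"
    using xy by (simp add: nn_integral_density nn_integral_scale_measure nn_integral_return)
  finally show ?thesis .
qed

lemma emeasure_P_MH:
  assumes xy: "x \<in> space MX" "y \<in> space MY" and A: "A \<in> sets MX"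
  shows "emeasure (P_MH MX p_XY q x y) A
    = (\<integral>\<^sup>+x'. ennreal (move_density x' x y) * indicator A x' \<partial>MX) + rejection x y * indicator A x"
  using nn_integral_P_MH[OF xy, of "indicator A"] A by simp

lemma prob_space_P_MH:
  assumes xy: "x \<in> space MX" "y \<in> space MY"
  shows "prob_space (P_MH MX p_XY q x y)"
proof
  have "space (P_MH MX p_XY q x y) = space MX" by (rule sets_eq_imp_space_eq) simp
  then have "emeasure (P_MH MX p_XY q x y) (space (P_MH MX p_XY q x y))
      = (\<integral>\<^sup>+x'. ennreal (move_density x' x y) \<partial>MX) + rejection x y"
    using xy by (simp add: emeasure_P_MH cong: nn_integral_cong)
  also have "\<dots> = 1"
    unfolding rejection_def using move_density_integral_le_1[OF xy] by (rule add_diff_inverse_ennreal)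
  finally show "emeasure (P_MH MX p_XY q x y) (space (P_MH MX p_XY q x y)) = 1" .
qed

lemma P_MH_measurable [measurable]:
  "(\<lambda>(x, y). P_MH MX p_XY q x y) \<in> MX \<Otimes>\<^sub>M MY \<rightarrow>\<^sub>M prob_algebra MX"
proof (intro measurable_prob_algebraI measurable_subprob_algebra)
  fix A assume [measurable]: "A \<in> sets MX"
  have "(\<lambda>z. (\<integral>\<^sup>+x'. ennreal (move_density x' (fst z) (snd z)) * indicator A x' \<partial>MX)
      + rejection (fst z) (snd z) * indicator A (fst z)) \<in> borel_measurable (MX \<Otimes>\<^sub>M MY)"
    unfolding rejection_def by measurable
  then show "(\<lambda>z. emeasure (case z of (x, y) \<Rightarrow> P_MH MX p_XY q x y) A) \<in> borel_measurable (MX \<Otimes>\<^sub>M MY)"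
    by (rule measurable_cong[THEN iffD1, rotated])
       (auto simp: space_pair_measure emeasure_P_MH split: prod.splits)
qed (auto simp: space_pair_measure prob_space_P_MH prob_space_imp_subprob_space)

definition MH_kernel :: "'a \<times> 'b \<Rightarrow> ('a \<times> 'b) measure" where
  "MH_kernel = (\<lambda>(x, y). distr (P_MH MX p_XY q x y) (MX \<Otimes>\<^sub>M MY) (\<lambda>x'. (x', y)))"

definition Gibbs_kernel :: "'a \<times> 'b \<Rightarrow> ('a \<times> 'b) measure" where
  "Gibbs_kernel = (\<lambda>(x, y). distr (K_YX x) (MX \<Otimes>\<^sub>M MY) (\<lambda>y'. (x, y')))"

lemma MH_kernel_measurable: "MH_kernel \<in> MX \<Otimes>\<^sub>M MY \<rightarrow>\<^sub>M prob_algebra (MX \<Otimes>\<^sub>M MY)"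
  unfolding MH_kernel_def by measurable

lemma Gibbs_kernel_measurable: "Gibbs_kernel \<in> MX \<Otimes>\<^sub>M MY \<rightarrow>\<^sub>M prob_algebra (MX \<Otimes>\<^sub>M MY)"
proof -
  note kernel_YX[measurable]
  show ?thesis unfolding Gibbs_kernel_def by measurable
qed

lemma sets_K_YX: "x \<in> space MX \<Longrightarrow> sets (K_YX x) = sets MY"
  and prob_K_YX: "x \<in> space MX \<Longrightarrow> prob_space (K_YX x)"
  using measurable_space[OF kernel_YX] by (auto simp: space_prob_algebra)

lemma nn_integral_J_YX:
  assumes "f \<in> borel_measurable (MX \<Otimes>\<^sub>M MY)"
  shows "(\<integral>\<^sup>+z. f z \<partial>J) = (\<integral>\<^sup>+x. \<integral>\<^sup>+y. f (x, y) \<partial>K_YX x \<partial>distr J MX fst)"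
  by (rule nn_integral_disintegration[OF prob_space_axioms sets_J kernel_YX conditional_YX assms])

text \<open>
  The disintegration lemma conditions on the first component, so it is applied to the image of \<open>J\<close>
  under the swap of coordinates.
\<close>
lemma nn_integral_J_XY:
  assumes f[measurable]: "f \<in> borel_measurable (MX \<Otimes>\<^sub>M MY)"
  shows "(\<integral>\<^sup>+z. f z \<partial>J)
    = (\<integral>\<^sup>+y. \<integral>\<^sup>+x. ennreal (p_XY x y) * f (x, y) \<partial>MX \<partial>distr J MY snd)"
proof -
  note sets_J[measurable_cong] p_XY_measurable[measurable]
  let ?J' = "distr J (MY \<Otimes>\<^sub>M MX) (\<lambda>(x, y). (y, x))"
  have fst': "distr ?J' MY fst = distr J MY snd"
    by (subst distr_distr) (auto simp: comp_def case_prod_beta)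
  have "(\<integral>\<^sup>+z. f z \<partial>J) = (\<integral>\<^sup>+z. f (snd z, fst z) \<partial>?J')"
    by (subst nn_integral_distr) (auto simp: case_prod_beta)
  also have "\<dots> = (\<integral>\<^sup>+y. \<integral>\<^sup>+x. f (snd (y, x), fst (y, x)) \<partial>K_XY y \<partial>distr ?J' MY fst)"
  proof (rule nn_integral_disintegration[OF _ _ kernel_XY])
    show "prob_space ?J'" by (rule prob_space_distr) simp
    fix B A assume [measurable]: "B \<in> sets MY" "A \<in> sets MX"
    have "emeasure ?J' (B \<times> A) = emeasure J (A \<times> B)"
      using sets.sets_into_space[of "A \<times> B" J]
      by (subst emeasure_distr) (auto intro!: arg_cong[where f="emeasure J"])
    then show "emeasure ?J' (B \<times> A) = (\<integral>\<^sup>+y\<in>B. emeasure (K_XY y) A \<partial>distr ?J' MY fst)"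
      unfolding fst' by (simp add: conditional_XY)
  qed simp_all
  also have "\<dots> = (\<integral>\<^sup>+y. \<integral>\<^sup>+x. ennreal (p_XY x y) * f (x, y) \<partial>MX \<partial>distr J MY snd)"
    unfolding fst'
  proof (intro nn_integral_cong)
    fix y assume "y \<in> space (distr J MY snd)"
    then have y: "y \<in> space MY" by simp
    then have [measurable]: "(\<lambda>x. p_XY x y) \<in> borel_measurable MX"
      using measurable_compose[OF _ p_XY_measurable, of "\<lambda>x. (x, y)" MX] by simp
    show "(\<integral>\<^sup>+x. f (snd (y, x), fst (y, x)) \<partial>K_XY y) = (\<integral>\<^sup>+x. ennreal (p_XY x y) * f (x, y) \<partial>MX)"
      using y unfolding density_XY[OF y] by (subst nn_integral_density) auto
  qed
  finally show ?thesis .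
qed

lemma nn_integral_MH_kernel:
  assumes "x \<in> space MX" "y \<in> space MY" and [measurable]: "g \<in> borel_measurable (MX \<Otimes>\<^sub>M MY)"
  shows "(\<integral>\<^sup>+w. g w \<partial>MH_kernel (x, y))
    = (\<integral>\<^sup>+x'. ennreal (move_density x' x y) * g (x', y) \<partial>MX) + rejection x y * g (x, y)"
proof -
  have "(\<integral>\<^sup>+w. g w \<partial>MH_kernel (x, y)) = (\<integral>\<^sup>+x'. g (x', y) \<partial>P_MH MX p_XY q x y)"
    unfolding MH_kernel_def using assms by (simp add: nn_integral_distr)
  then show ?thesis using assms by (simp add: nn_integral_P_MH)
qed

text \<open>
  For fixed \<open>y\<close> the pairing splits into a double integral over accepted moves and a diagonal part
  from rejections. The diagonal part is visibly symmetric in \<open>f\<close> and \<open>g\<close>, so reversibility only has to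
  be checked for the double integral.
\<close>
lemma MH_fibre_expansion:
  assumes y: "y \<in> space MY"
    and [measurable]: "f \<in> borel_measurable (MX \<Otimes>\<^sub>M MY)" "g \<in> borel_measurable (MX \<Otimes>\<^sub>M MY)"
  shows "(\<integral>\<^sup>+x. ennreal (p_XY x y) * (f (x, y) * (\<integral>\<^sup>+w. g w \<partial>MH_kernel (x, y))) \<partial>MX)
    = (\<integral>\<^sup>+x. \<integral>\<^sup>+x'. ennreal (p_XY x y * move_density x' x y) * (f (x, y) * g (x', y)) \<partial>MX \<partial>MX)
      + (\<integral>\<^sup>+x. ennreal (p_XY x y) * rejection x y * (f (x, y) * g (x, y)) \<partial>MX)"
proof -
  have [measurable]: "(\<lambda>x. p_XY x y) \<in> borel_measurable MX"
    using y measurable_compose[OF _ p_XY_measurable, of "\<lambda>x. (x, y)" MX] by simp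
  have [measurable]: "(\<lambda>x. rejection x y) \<in> borel_measurable MX"
    unfolding rejection_def using y by measurable
  have "(\<integral>\<^sup>+x. ennreal (p_XY x y) * (f (x, y) * (\<integral>\<^sup>+w. g w \<partial>MH_kernel (x, y))) \<partial>MX)
    = (\<integral>\<^sup>+x. (\<integral>\<^sup>+x'. ennreal (p_XY x y * move_density x' x y) * (f (x, y) * g (x', y)) \<partial>MX)
      + ennreal (p_XY x y) * rejection x y * (f (x, y) * g (x, y)) \<partial>MX)"
  proof (intro nn_integral_cong)
    fix x assume x: "x \<in> space MX"
    have "(\<integral>\<^sup>+x'. ennreal (p_XY x y * move_density x' x y) * (f (x, y) * g (x', y)) \<partial>MX)
        = (\<integral>\<^sup>+x'. (ennreal (p_XY x y) * f (x, y)) * (ennreal (move_density x' x y) * g (x', y)) \<partial>MX)"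
      using x y by (intro nn_integral_cong) (simp add: ennreal_mult p_XY_nonneg move_density_nonneg ac_simps)
    also have "\<dots> = (ennreal (p_XY x y) * f (x, y)) * (\<integral>\<^sup>+x'. ennreal (move_density x' x y) * g (x', y) \<partial>MX)"
      using x y by (intro nn_integral_cmult) measurable
    finally show "ennreal (p_XY x y) * (f (x, y) * (\<integral>\<^sup>+w. g w \<partial>MH_kernel (x, y)))
      = (\<integral>\<^sup>+x'. ennreal (p_XY x y * move_density x' x y) * (f (x, y) * g (x', y)) \<partial>MX)
        + ennreal (p_XY x y) * rejection x y * (f (x, y) * g (x, y))"
      using x y by (simp add: nn_integral_MH_kernel distrib_left ac_simps)
  qed
  also have "\<dots> = (\<integral>\<^sup>+x. \<integral>\<^sup>+x'. ennreal (p_XY x y * move_density x' x y) * (f (x, y) * g (x', y)) \<partial>MX \<partial>MX)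
      + (\<integral>\<^sup>+x. ennreal (p_XY x y) * rejection x y * (f (x, y) * g (x, y)) \<partial>MX)"
    using y by (intro nn_integral_add) measurable
  finally show ?thesis .
qed

lemma MH_fibre_symmetric:
  assumes y: "y \<in> space MY"
    and f[measurable]: "f \<in> borel_measurable (MX \<Otimes>\<^sub>M MY)" and g[measurable]: "g \<in> borel_measurable (MX \<Otimes>\<^sub>M MY)"
  shows "(\<integral>\<^sup>+x. ennreal (p_XY x y) * (f (x, y) * (\<integral>\<^sup>+w. g w \<partial>MH_kernel (x, y))) \<partial>MX)
    = (\<integral>\<^sup>+x. ennreal (p_XY x y) * (g (x, y) * (\<integral>\<^sup>+w. f w \<partial>MH_kernel (x, y))) \<partial>MX)"
proof -
  interpret XX: pair_sigma_finite MX MX ..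
  have [measurable]: "(\<lambda>x. p_XY x y) \<in> borel_measurable MX"
    using y measurable_compose[OF _ p_XY_measurable, of "\<lambda>x. (x, y)" MX] by simp
  have "(\<integral>\<^sup>+x. \<integral>\<^sup>+x'. ennreal (p_XY x y * move_density x' x y) * (f (x, y) * g (x', y)) \<partial>MX \<partial>MX)
      = (\<integral>\<^sup>+x'. \<integral>\<^sup>+x. ennreal (p_XY x y * move_density x' x y) * (f (x, y) * g (x', y)) \<partial>MX \<partial>MX)"
    using y by (intro XX.Fubini'[symmetric]) measurable
  also have "\<dots> = (\<integral>\<^sup>+x'. \<integral>\<^sup>+x. ennreal (p_XY x' y * move_density x x' y) * (g (x', y) * f (x, y)) \<partial>MX \<partial>MX)"
    using y by (intro nn_integral_cong) (simp add: move_density_balance mult.commute[of "f _"])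
  finally show ?thesis
    unfolding MH_fibre_expansion[OF y f g] MH_fibre_expansion[OF y g f]
    by (simp add: mult.commute[of "f _"])
qed

lemma measurable_J_iff: "f \<in> borel_measurable J \<longleftrightarrow> f \<in> borel_measurable (MX \<Otimes>\<^sub>M MY)"
  by (simp cong: measurable_cong_sets add: sets_J)

lemma prob_algebra_J: "J \<rightarrow>\<^sub>M prob_algebra J = (MX \<Otimes>\<^sub>M MY) \<rightarrow>\<^sub>M prob_algebra (MX \<Otimes>\<^sub>M MY)"
  by (intro measurable_cong_sets sets_J) (simp add: prob_algebra_def subprob_algebra_cong[OF sets_J])

text \<open>
  Reversibility holds on every fibre \<open>{y}\<close> with respect to the conditional distribution of \<open>x\<close> given
  \<open>y\<close>; the update never leaves the fibre, so integrating over \<open>y\<close> gives it for \<open>J\<close>.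
\<close>
sublocale MH: reversible_kernel J MH_kernel
proof
  show "MH_kernel \<in> J \<rightarrow>\<^sub>M prob_algebra J"
    unfolding prob_algebra_J by (rule MH_kernel_measurable)
  fix f g :: "'a \<times> 'b \<Rightarrow> ennreal"
  assume "f \<in> borel_measurable J" "g \<in> borel_measurable J"
  then have f[measurable]: "f \<in> borel_measurable (MX \<Otimes>\<^sub>M MY)" and g[measurable]: "g \<in> borel_measurable (MX \<Otimes>\<^sub>M MY)"
    by (simp_all add: measurable_J_iff)
  have K[measurable]: "(\<lambda>z. \<integral>\<^sup>+w. h w \<partial>MH_kernel z) \<in> borel_measurable (MX \<Otimes>\<^sub>M MY)"
    if "h \<in> borel_measurable (MX \<Otimes>\<^sub>M MY)" for h :: "'a \<times> 'b \<Rightarrow> ennreal"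
    using measurable_prob_algebraD[OF MH_kernel_measurable] nn_integral_measurable_subprob_algebra[OF that]
    by (rule measurable_compose)
  have "(\<integral>\<^sup>+z. f z * (\<integral>\<^sup>+w. g w \<partial>MH_kernel z) \<partial>J)
      = (\<integral>\<^sup>+z. g z * (\<integral>\<^sup>+w. f w \<partial>MH_kernel z) \<partial>J)"
    by (subst (1 2) nn_integral_J_XY, simp_all, rule nn_integral_cong, rule MH_fibre_symmetric) simp_all
  then show "(\<integral>\<^sup>+z. f z * (\<integral>\<^sup>+w. g w \<partial>MH_kernel z) \<partial>J)
      = (\<integral>\<^sup>+z. (\<integral>\<^sup>+w. f w \<partial>MH_kernel z) * g z \<partial>J)"
    by (simp add: mult.commute)
qed

text \<open>
  The Gibbs update forgets \<open>y\<close>: on test functions it is the conditional expectation given \<open>x\<close>, so both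
  sides are the integral over \<open>x\<close> of the product of the conditional expectations of \<open>f\<close> and \<open>g\<close>.
\<close>
sublocale Gibbs: reversible_kernel J Gibbs_kernel
proof
  show "Gibbs_kernel \<in> J \<rightarrow>\<^sub>M prob_algebra J"
    unfolding prob_algebra_J by (rule Gibbs_kernel_measurable)
  fix f g :: "'a \<times> 'b \<Rightarrow> ennreal"
  assume "f \<in> borel_measurable J" "g \<in> borel_measurable J"
  then have f[measurable]: "f \<in> borel_measurable (MX \<Otimes>\<^sub>M MY)" and g[measurable]: "g \<in> borel_measurable (MX \<Otimes>\<^sub>M MY)"
    by (simp_all add: measurable_J_iff)
  have K[measurable]: "(\<lambda>z. \<integral>\<^sup>+w. h w \<partial>Gibbs_kernel z) \<in> borel_measurable (MX \<Otimes>\<^sub>M MY)"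
    if "h \<in> borel_measurable (MX \<Otimes>\<^sub>M MY)" for h :: "'a \<times> 'b \<Rightarrow> ennreal"
    using measurable_prob_algebraD[OF Gibbs_kernel_measurable] nn_integral_measurable_subprob_algebra[OF that]
    by (rule measurable_compose)
  have Gibbs: "(\<integral>\<^sup>+w. h w \<partial>Gibbs_kernel (x, y)) = (\<integral>\<^sup>+y'. h (x, y') \<partial>K_YX x)"
    if "x \<in> space MX" and [measurable]: "h \<in> borel_measurable (MX \<Otimes>\<^sub>M MY)" for h x y
  proof -
    note sets_K_YX[OF that(1), measurable_cong]
    show ?thesis unfolding Gibbs_kernel_def using that(1) by (simp add: nn_integral_distr)
  qed
  show "(\<integral>\<^sup>+z. f z * (\<integral>\<^sup>+w. g w \<partial>Gibbs_kernel z) \<partial>J)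
      = (\<integral>\<^sup>+z. (\<integral>\<^sup>+w. f w \<partial>Gibbs_kernel z) * g z \<partial>J)"
  proof (subst (1 2) nn_integral_J_YX)
    show "(\<integral>\<^sup>+x. \<integral>\<^sup>+y. f (x, y) * (\<integral>\<^sup>+w. g w \<partial>Gibbs_kernel (x, y)) \<partial>K_YX x \<partial>distr J MX fst)
      = (\<integral>\<^sup>+x. \<integral>\<^sup>+y. (\<integral>\<^sup>+w. f w \<partial>Gibbs_kernel (x, y)) * g (x, y) \<partial>K_YX x \<partial>distr J MX fst)"
    proof (rule nn_integral_cong)
      fix x assume "x \<in> space (distr J MX fst)"
      then have x: "x \<in> space MX" by simp
      note sets_K_YX[OF x, measurable_cong]
      show "(\<integral>\<^sup>+y. f (x, y) * (\<integral>\<^sup>+w. g w \<partial>Gibbs_kernel (x, y)) \<partial>K_YX x)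
          = (\<integral>\<^sup>+y. (\<integral>\<^sup>+w. f w \<partial>Gibbs_kernel (x, y)) * g (x, y) \<partial>K_YX x)"
        using x by (simp add: Gibbs nn_integral_cmult nn_integral_multc)
    qed
  qed simp_all
qed

sublocale scan_kernels J MH_kernel Gibbs_kernel
proof
  fix f :: "'a \<times> 'b \<Rightarrow> real" and z
  assume f: "f \<in> borel_measurable J" and "z \<in> space J"
  then obtain x y where z: "z = (x, y)" and x: "x \<in> space MX" and y: "y \<in> space MY"
    using sets_eq_imp_space_eq[OF sets_J] by (auto simp: space_pair_measure)
  interpret K: prob_space "K_YX x" by (rule prob_K_YX[OF x])
  have [measurable]: "kernel_op Gibbs_kernel f \<in> borel_measurable (MX \<Otimes>\<^sub>M MY)"
    using Gibbs.kernel_op_measurable[OF f] by (simp add: measurable_J_iff)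
  have const: "kernel_op Gibbs_kernel f (x, y') = kernel_op Gibbs_kernel f (x, y)" for y'
    by (simp add: kernel_op_def Gibbs_kernel_def)
  note sets_K_YX[OF x, measurable_cong]
  have "kernel_op Gibbs_kernel (kernel_op Gibbs_kernel f) (x, y)
      = (\<integral>w. kernel_op Gibbs_kernel f w \<partial>distr (K_YX x) (MX \<Otimes>\<^sub>M MY) (\<lambda>y'. (x, y')))"
    by (simp add: kernel_op_def[of _ "kernel_op Gibbs_kernel f"]) (simp add: Gibbs_kernel_def)
  also have "\<dots> = (\<integral>y'. kernel_op Gibbs_kernel f (x, y') \<partial>K_YX x)"
    using x by (intro integral_distr) measurable
  also have "\<dots> = kernel_op Gibbs_kernel f (x, y)"
    by (subst const) (simp add: K.prob_space)
  finally show "kernel_op Gibbs_kernel (kernel_op Gibbs_kernel f) z = kernel_op Gibbs_kernel f z"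
    by (simp add: z)
qed

lemma P_DC_eq:
  assumes "z \<in> space J"
  shows "P_DC MX MY K_YX p_XY q z = Gibbs_kernel z \<bind> MH_kernel"
proof -
  obtain x y where z: "z = (x, y)" and x: "x \<in> space MX" and y: "y \<in> space MY"
    using assms sets_eq_imp_space_eq[OF sets_J] by (auto simp: space_pair_measure)
  note sets_K_YX[OF x, measurable_cong]
  have "Gibbs_kernel z \<bind> MH_kernel = K_YX x \<bind> (\<lambda>y'. MH_kernel (x, y'))"
    unfolding z Gibbs_kernel_def using x prob_space.not_empty[OF prob_K_YX[OF x]]
    by (simp, intro bind_distr[OF _ measurable_prob_algebraD[OF MH_kernel_measurable]]) simp_all
  then show ?thesis by (simp add: P_DC_def MH_kernel_def z)
qed

lemma emeasure_P_RC:
  assumes "A \<in> sets J"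
  shows "emeasure (P_RC MX MY K_YX p_XY q r z) A
    = ennreal r * emeasure (MH_kernel z) A + ennreal (1 - r) * emeasure (Gibbs_kernel z) A"
  using assms
  by (cases z) (simp add: P_RC_def MH_kernel_def Gibbs_kernel_def emeasure_add_measure sets_J)

end

section \<open>Comparison of the two scans\<close>

theorem proposition5p3:
  fixes MX :: "'a measure" and MY :: "'b measure" and J :: "('a \<times> 'b) measure"
    and K_XY :: "'b \<Rightarrow> 'a measure" and K_YX :: "'a \<Rightarrow> 'b measure"
    and p_XY :: "'a \<Rightarrow> 'b \<Rightarrow> real" and p_YX :: "'b \<Rightarrow> 'a \<Rightarrow> real"
    and q :: "'a \<Rightarrow> 'a \<Rightarrow> 'b \<Rightarrow> real" and r :: real
  assumes "cond_MH_setting MX MY J K_XY K_YX p_XY p_YX q"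
    and "0 < r" and "r < 1"
    and "L2_rate J (P_DC MX MY K_YX p_XY q) < 1"
  shows "L2_rate J (P_RC MX MY K_YX p_XY q r) < 1"
proof -
  interpret cond_MH_setting MX MY J K_XY K_YX p_XY p_YX q by (rule assms(1))
  show ?thesis
  proof (rule rate_less_1_transfer)
    show "density_kernel J (P_DC MX MY K_YX p_XY q) compound"
      by (rule density_kernel_compound[OF P_DC_eq])
    show "density_kernel J (P_RC MX MY K_YX p_XY q r) (mixture r)"
    proof (rule density_kernel_mixture)
      show "sets (P_RC MX MY K_YX p_XY q r z) = sets J" for z
        by (cases z) (simp add: P_RC_def sets_J)
    qed (use assms(2,3) in \<open>auto simp: emeasure_P_RC\<close>)
  qed (use assms in auto)
qed

end
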